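(* Let $(W,S)$ be a finite Coxeter system. A simplicial complex is isomorphic to a subword complex $\Delta(Q,\pi)$ of type $W$ which is a simplicial sphere (with $Q$ a word in $S$ and $\pi\in W$) if and only if it is isomorphic to the link of a face of a multi-cluster complex $\Delta^k_c(W)$ for some integer $k\geq0$ and some Coxeter element $c$.
   Context: For a word $Q=(q_1,\dots,q_r)$ in $S$ and $\pi\in W$, the subword complex $\Delta(Q,\pi)$ is the simplicial complex on the positions of $Q$ whose faces are the sets $P$ of positions such that deleting them from $Q$ leaves a word containing a reduced expression for $\pi$ as a subword. A Coxeter element $c$ is the product of all elements of $S$ in some order, with reduced word $\mathbf{c}$; $w_\circ$ is the longest element; $\mathbf{w}_\circ(\mathbf{c})$ is the lexicographically first (as a sequence of positions) subword of $\mathbf{c}\mathbf{c}\mathbf{c}\cdots$ which is a reduced expression for $w_\circ$; the multi-cluster complex is $\Delta^k_c(W)=\Delta(\mathbf{c}^k\mathbf{w}_\circ(\mathbf{c}),w_\circ)$. The link of a face $F$ in a simplicial complex $\Delta$ is $\{G\in\Delta: G\cap F=\emptyset,\ G\cup F\in\Delta\}$. *)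

theory Defs
  imports
    "HOL-Algebra.Multiplicative_Group"
    "HOL-Analysis.Abstract_Euclidean_Space"
    "HOL-Library.Sublist"
begin

section \<open>Coxeter systems\<close>

definition word_prod :: "('a, 'b) monoid_scheme \<Rightarrow> 'a list \<Rightarrow> 'a" where
  "word_prod G w = foldr (\<otimes>\<^bsub>G\<^esub>) w \<one>\<^bsub>G\<^esub>"

text \<open>
  The step relation deletes one relator \<open>(s t)\<^sup>m\<close>, where \<open>m\<close> is the order of \<open>s t\<close>; pairs with
  \<open>s t\<close> of infinite order (\<open>ord = 0\<close>) contribute no relator. The case \<open>s = t\<close> has \<open>m = 1\<close> and gives
  the relator \<open>s s\<close>, so every generator is its own inverse and words over \<open>S\<close> need no
  inverse letters.
\<close>
inductive coxeter_step :: "('a, 'b) monoid_scheme \<Rightarrow> 'a set \<Rightarrow> 'a list \<Rightarrow> 'a list \<Rightarrow> bool"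
  for G :: "('a, 'b) monoid_scheme" and S :: "'a set" where
  "\<lbrakk> u \<in> lists S; v \<in> lists S; s \<in> S; t \<in> S; group.ord G (s \<otimes>\<^bsub>G\<^esub> t) \<noteq> 0 \<rbrakk>
   \<Longrightarrow> coxeter_step G S
         (u @ concat (replicate (group.ord G (s \<otimes>\<^bsub>G\<^esub> t)) [s, t]) @ v) (u @ v)"

text \<open>
  As in Bourbaki: \<open>S\<close> is a generating set of elements of order 2, and the relations
  \<open>(s t)\<^sup>m = 1\<close> form a presentation of the group, that is, two words over \<open>S\<close> with the same
  product are related by inserting and deleting relators.
\<close>
locale coxeter_system = group G for G :: "('a, 'b) monoid_scheme" (structure) +
  fixes S :: "'a set"
  assumes gens_subset: "S \<subseteq> carrier G"
    and gens_ord: "s \<in> S \<Longrightarrow> ord s = 2"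
    and gens_generate: "generate G S = carrier G"
    and presentation: "\<lbrakk> u \<in> lists S; v \<in> lists S; word_prod G u = word_prod G v \<rbrakk>
                       \<Longrightarrow> equivclp (coxeter_step G S) u v"

definition cox_length :: "('a, 'b) monoid_scheme \<Rightarrow> 'a set \<Rightarrow> 'a \<Rightarrow> nat" where
  "cox_length G S x = (LEAST n. \<exists>w\<in>lists S. word_prod G w = x \<and> length w = n)"

definition reduced_expression :: "('a, 'b) monoid_scheme \<Rightarrow> 'a set \<Rightarrow> 'a list \<Rightarrow> 'a \<Rightarrow> bool" where
  "reduced_expression G S w x \<longleftrightarrow>
     w \<in> lists S \<and> word_prod G w = x \<and> length w = cox_length G S x"

definition longest_element :: "('a, 'b) monoid_scheme \<Rightarrow> 'a set \<Rightarrow> 'a" where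
  "longest_element G S =
     (THE x. x \<in> carrier G \<and> (\<forall>y\<in>carrier G. cox_length G S y \<le> cox_length G S x))"

definition coxeter_element :: "('a, 'b) monoid_scheme \<Rightarrow> 'a set \<Rightarrow> 'a \<Rightarrow> bool" where
  "coxeter_element G S c \<longleftrightarrow> (\<exists>w. distinct w \<and> set w = S \<and> word_prod G w = c)"

section \<open>Abstract simplicial complexes\<close>

definition abstract_simplicial_complex :: "'v set set \<Rightarrow> bool" where
  "abstract_simplicial_complex K \<longleftrightarrow> (\<forall>F\<in>K. finite F \<and> (\<forall>G. G \<subseteq> F \<longrightarrow> G \<in> K))"

text \<open>The vertices of \<open>K\<close> are the elements of \<open>\<Union>K\<close>.\<close>
definition simplicial_isomorphic :: "'v set set \<Rightarrow> 'w set set \<Rightarrow> bool" where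
  "simplicial_isomorphic K L \<longleftrightarrow> (\<exists>f. bij_betw f (\<Union>K) (\<Union>L) \<and> (\<lambda>F. f ` F) ` K = L)"

definition link :: "'v set set \<Rightarrow> 'v set \<Rightarrow> 'v set set" where
  "link K F = {G \<in> K. G \<inter> F = {} \<and> G \<union> F \<in> K}"

text \<open>
  Points are given by their barycentric coordinates. For a finite complex the product topology
  used here is the usual topology of the realization.
\<close>
definition geometric_realization :: "'v set set \<Rightarrow> ('v \<Rightarrow> real) topology" where
  "geometric_realization K =
     subtopology (powertop_real UNIV)
       {x. (\<forall>v. 0 \<le> x v) \<and> {v. x v \<noteq> 0} \<in> K \<and> (\<Sum>v\<in>{v. x v \<noteq> 0}. x v) = 1}"

text \<open>
  The complex \<open>{{}}\<close>, whose only face is the empty one, is the sphere of dimension \<open>-1\<close>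
  (it is the link of a facet); the void complex \<open>{}\<close> is not a sphere.
\<close>
definition simplicial_sphere :: "'v set set \<Rightarrow> bool" where
  "simplicial_sphere K \<longleftrightarrow>
     abstract_simplicial_complex K \<and> finite K \<and>
     (K = {{}} \<or> (\<exists>n. geometric_realization K homeomorphic_space nsphere n))"

section \<open>Subword complexes and multi-cluster complexes\<close>

text \<open>Positions are counted from 0.\<close>
definition subword_complex ::
    "('a, 'b) monoid_scheme \<Rightarrow> 'a set \<Rightarrow> 'a list \<Rightarrow> 'a \<Rightarrow> nat set set" where
  "subword_complex G S Q x =
     {P. P \<subseteq> {..<length Q} \<and>
         (\<exists>w. subseq w (nths Q ({..<length Q} - P)) \<and> reduced_expression G S w x)}"

text \<open>
  The letter of the infinite word \<open>cw cw cw \<dots>\<close> at position \<open>i\<close> is \<open>cw ! (i mod length cw)\<close>.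
  If \<open>cw\<close> is empty (trivial group), the only position sequence below is the empty one.
\<close>
definition longest_positions ::
    "('a, 'b) monoid_scheme \<Rightarrow> 'a set \<Rightarrow> 'a list \<Rightarrow> nat list set" where
  "longest_positions G S cw =
     {ps. sorted_wrt (<) ps \<and>
          reduced_expression G S (map (\<lambda>i. cw ! (i mod length cw)) ps) (longest_element G S)}"

definition c_sorting_word :: "('a, 'b) monoid_scheme \<Rightarrow> 'a set \<Rightarrow> 'a list \<Rightarrow> 'a list" where
  "c_sorting_word G S cw =
     map (\<lambda>i. cw ! (i mod length cw))
       (THE ps. ps \<in> longest_positions G S cw \<and>
          (\<forall>qs\<in>longest_positions G S cw. qs \<noteq> ps \<longrightarrow> (ps, qs) \<in> lexord {(i, j). i < j}))"

definition multi_cluster_complex ::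
    "('a, 'b) monoid_scheme \<Rightarrow> 'a set \<Rightarrow> nat \<Rightarrow> 'a list \<Rightarrow> nat set set" where
  "multi_cluster_complex G S k cw =
     subword_complex G S (concat (replicate k cw) @ c_sorting_word G S cw) (longest_element G S)"

end

theory Submission
  imports Defs "HOL-Homology.Brouwer_Degree"
begin

text \<open>
  Let \<open>dem Q\<close> be the Demazure product of a word \<open>Q\<close>. Deleting the last letter of \<open>Q\<close> exhibits the
  subword complex \<open>\<Delta>(Q, x)\<close> as a cone or as the union of a smaller subword complex with a cone over
  a subcomplex of it. By induction \<open>\<Delta>(Q, x)\<close> is a sphere if \<open>dem Q = x\<close>, and otherwise it is void or a
  ball whose boundary consists of the faces \<open>P\<close> with \<open>dem (Q - P) \<noteq> x\<close>. The gluing steps are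
  realized by stellar subdivisions, since a ball may be replaced by the cone over its boundary.

  If \<open>dem Q = x\<close> and \<open>R\<close> is a reduced word for \<open>x\<inverse> w\<^sub>0\<close>, then \<open>\<Delta>(Q, x) = \<Delta>(Q R, w\<^sub>0)\<close>; as \<open>Q R\<close> is a
  subword of \<open>c\<^sup>k\<close> for large \<open>k\<close>, this is a link in a multi-cluster complex. Conversely the link of
  a face \<open>F\<close> of \<open>\<Delta>(Q, w\<^sub>0)\<close> is \<open>\<Delta>(Q - F, w\<^sub>0)\<close>, and a word containing a reduced word of the longest
  element has Demazure product \<open>w\<^sub>0\<close>.
\<close>

section \<open>Coxeter groups\<close>

text \<open>The obstacle is topological: gluing balls along balls in their boundaries by means of
  homeomorphisms usually calls for PL machinery. Here no homeomorphism is ever glued.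
  \<open>pball\<close> is a purely combinatorial class, whose base case even allows an arbitrary
  nonempty \<open>E\<close>; what is used of its members is that, inside any complex that meets them
  only in the second argument, they can be exchanged for the cone over that argument. This serves
  twice: the sphere step becomes a suspension, and a ball, being a cone up to homeomorphism, is
  contractible and hence no sphere. On the group side everything comes down to lengths.
  \<open>dem Q\<close> is the unique longest element with a reduced expression inside
  \<open>Q\<close>, and for a descent \<open>s\<close> the lengths of \<open>x\<close> and
  \<open>x s\<close> differ by one, so no Demazure product fits strictly between them. The exchange
  property behind this is derived from the presentation by a parity count, without roots or a
  geometric representation.\<close>

context coxeter_system
begin

declare in_listsD [rule del] in_listsI [rule del]

lemma rev_in_lists [simp]: "rev u \<in> lists S \<longleftrightarrow> u \<in> lists S"
  by (simp add: lists_eq_set)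

abbreviation wp :: "'a list \<Rightarrow> 'a" where "wp \<equiv> word_prod G"
abbreviation len :: "'a \<Rightarrow> nat" where "len \<equiv> cox_length G S"

section \<open>Products of words and Coxeter length\<close>

lemma gen_closed [simp]: "s \<in> S \<Longrightarrow> s \<in> carrier G"
  using gens_subset by blast

lemma gen_square [simp]: "s \<in> S \<Longrightarrow> s \<otimes> s = \<one>"
  using pow_ord_eq_1[of s] gens_ord[of s] by (simp add: numeral_2_eq_2)

lemma gen_inv [simp]: "s \<in> S \<Longrightarrow> inv s = s"
  by (simp add: inv_equality)

lemma gen_not_one: "s \<in> S \<Longrightarrow> s \<noteq> \<one>"
  using gens_ord[of s] ord_id by auto

lemma inv_mult_cancel [simp]: "\<lbrakk>x \<in> carrier G; y \<in> carrier G\<rbrakk> \<Longrightarrow> inv x \<otimes> (x \<otimes> y) = y"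
  by (metis inv_closed l_inv l_one m_assoc)

lemma mult_inv_cancel [simp]: "\<lbrakk>x \<in> carrier G; y \<in> carrier G\<rbrakk> \<Longrightarrow> x \<otimes> (inv x \<otimes> y) = y"
  by (metis inv_closed r_inv l_one m_assoc)

lemma gen_mult_cancel [simp]: "\<lbrakk>s \<in> S; y \<in> carrier G\<rbrakk> \<Longrightarrow> s \<otimes> (s \<otimes> y) = y"
  by (metis gen_square gen_closed l_one m_assoc)

lemma mult_gen_gen [simp]: "\<lbrakk>s \<in> S; y \<in> carrier G\<rbrakk> \<Longrightarrow> y \<otimes> s \<otimes> s = y"
  by (simp add: m_assoc)

lemma word_prod_Nil [simp]: "wp [] = \<one>"
  by (simp add: word_prod_def)

lemma word_prod_Cons [simp]: "wp (s # u) = s \<otimes> wp u"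
  by (simp add: word_prod_def)

lemma word_prod_closed [simp]: "u \<in> lists S \<Longrightarrow> wp u \<in> carrier G"
  by (induction u) auto

lemma word_prod_append [simp]:
  "\<lbrakk>u \<in> lists S; v \<in> lists S\<rbrakk> \<Longrightarrow> wp (u @ v) = wp u \<otimes> wp v"
  by (induction u) (auto simp: m_assoc)

lemma word_prod_rev: "u \<in> lists S \<Longrightarrow> wp (rev u) = inv (wp u)"
  by (induction u) (auto simp: inv_mult_group)

lemma word_exists:
  assumes "x \<in> carrier G" shows "\<exists>u\<in>lists S. wp u = x"
proof -
  have "x \<in> generate G S" using assms gens_generate by simp
  then show ?thesis
  proof (induction rule: generate.induct)
    case one then show ?case by (rule bexI[of _ "[]"]) auto
  next
    case (incl h) then show ?case by (intro bexI[of _ "[h]"]) auto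
  next
    case (inv h) then show ?case by (intro bexI[of _ "[h]"]) auto
  next
    case (eng h1 h2)
    then obtain u v where "u \<in> lists S" "v \<in> lists S" "wp u = h1" "wp v = h2" by blast
    then show ?case by (intro bexI[of _ "u @ v"]) auto
  qed
qed

lemma reduced_exists:
  assumes "x \<in> carrier G" shows "\<exists>u. reduced_expression G S u x"
proof -
  from word_exists[OF assms] obtain u where "u \<in> lists S" "wp u = x" by blast
  then have "\<exists>w\<in>lists S. wp w = x \<and> length w = length u" by blast
  then have "\<exists>w\<in>lists S. wp w = x \<and> length w = len x"
    unfolding cox_length_def by (rule LeastI)
  then show ?thesis unfolding reduced_expression_def by blast
qed

lemma cox_length_le: "u \<in> lists S \<Longrightarrow> len (wp u) \<le> length u"
  unfolding cox_length_def by (rule Least_le) blast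

lemma cox_length_mult_le:
  assumes "x \<in> carrier G" "y \<in> carrier G" shows "len (x \<otimes> y) \<le> len x + len y"
proof -
  from reduced_exists[OF assms(1)] reduced_exists[OF assms(2)] obtain u v
    where "reduced_expression G S u x" "reduced_expression G S v y" by blast
  then show ?thesis using cox_length_le[of "u @ v"] by (auto simp: reduced_expression_def)
qed

lemma cox_length_one [simp]: "len \<one> = 0"
  using cox_length_le[of "[]"] by simp

lemma cox_length_eq_0: assumes "x \<in> carrier G" "len x = 0" shows "x = \<one>"
  using reduced_exists[OF assms(1)] assms(2) by (auto simp: reduced_expression_def)

lemma cox_length_gen: assumes "s \<in> S" shows "len s = 1"
proof -
  have "len s \<le> 1" using cox_length_le[of "[s]"] assms by simp
  moreover have "len s \<noteq> 0" using cox_length_eq_0[of s] gen_not_one assms by auto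
  ultimately show ?thesis by simp
qed

lemma cox_length_mult_gen_le: "\<lbrakk>x \<in> carrier G; s \<in> S\<rbrakk> \<Longrightarrow> len (x \<otimes> s) \<le> len x + 1"
  using cox_length_mult_le[of x s] by (simp add: cox_length_gen)

lemma cox_length_le_mult_gen: "\<lbrakk>x \<in> carrier G; s \<in> S\<rbrakk> \<Longrightarrow> len x \<le> len (x \<otimes> s) + 1"
  using cox_length_mult_gen_le[of "x \<otimes> s" s] by simp

subsection \<open>Reflections and the strong exchange property\<close>

text \<open>The number of prefixes \<open>p s\<close> of the word with \<open>t = p s p\<inverse>\<close>. Its parity depends only on the
  product of the word, since a relator passes each reflection of its dihedral group twice.\<close>

primrec nref :: "'a list \<Rightarrow> 'a \<Rightarrow> nat" where
  "nref [] t = 0"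
| "nref (s # u) t = (if t = s then 1 else 0) + nref u (s \<otimes> t \<otimes> s)"

lemma nref_append:
  "\<lbrakk>u \<in> lists S; t \<in> carrier G\<rbrakk> \<Longrightarrow> nref (u @ v) t = nref u t + nref v (inv (wp u) \<otimes> t \<otimes> wp u)"
  by (induction u arbitrary: t) (auto simp: inv_mult_group m_assoc)

text \<open>The letter at index \<open>i\<close> of \<open>s t s t ...\<close>, conjugated by the
  prefix before it, is the alternating word of length \<open>2 i + 1\<close>, that is
  \<open>(s t)^i s\<close>.\<close>

lemma nref_relator_sum:
  assumes "s \<in> S" "t \<in> S"
  shows "r \<in> carrier G \<Longrightarrow> nref (concat (replicate k [s, t])) r =
    (\<Sum>i<2*k. if r = (s \<otimes> t) [^] i \<otimes> s then 1 else 0)"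
proof (induction k arbitrary: r)
  case 0 then show ?case by simp
next
  case (Suc k)
  let ?p = "s \<otimes> t"
  have c: "?p \<in> carrier G" "t \<otimes> (s \<otimes> r \<otimes> s) \<otimes> t \<in> carrier G" using assms Suc by auto
  have e1: "s \<otimes> r \<otimes> s = t \<longleftrightarrow> r = ?p [^] (1::nat) \<otimes> s"
  proof
    assume "s \<otimes> r \<otimes> s = t"
    then have "s \<otimes> (s \<otimes> r \<otimes> s) \<otimes> s = s \<otimes> t \<otimes> s" by simp
    then show "r = ?p [^] (1::nat) \<otimes> s" using assms Suc by (simp add: m_assoc)
  qed (use assms Suc in \<open>simp add: m_assoc\<close>)
  have e2: "t \<otimes> (s \<otimes> r \<otimes> s) \<otimes> t = ?p [^] i \<otimes> s \<longleftrightarrow> r = ?p [^] (Suc (Suc i)) \<otimes> s" for i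
  proof -
    have p2: "?p [^] (Suc (Suc i)) = ?p \<otimes> ?p [^] i \<otimes> ?p"
      using nat_pow_Suc2[OF c(1), of i] c by (simp add: m_assoc)
    have pc: "?p [^] i \<in> carrier G" using c by simp
    show ?thesis
    proof
      assume "t \<otimes> (s \<otimes> r \<otimes> s) \<otimes> t = ?p [^] i \<otimes> s"
      then have "s \<otimes> (t \<otimes> (t \<otimes> (s \<otimes> r \<otimes> s) \<otimes> t) \<otimes> t) \<otimes> s = s \<otimes> (t \<otimes> (?p [^] i \<otimes> s) \<otimes> t) \<otimes> s" by simp
      then show "r = ?p [^] (Suc (Suc i)) \<otimes> s" unfolding p2
        using assms Suc pc by (simp add: m_assoc)
    next
      assume "r = ?p [^] (Suc (Suc i)) \<otimes> s"
      then show "t \<otimes> (s \<otimes> r \<otimes> s) \<otimes> t = ?p [^] i \<otimes> s" unfolding p2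
        using assms pc by (simp add: m_assoc)
    qed
  qed
  let ?f = "\<lambda>i::nat. if r = ?p [^] i \<otimes> s then 1 else (0::nat)"
  have "nref (concat (replicate (Suc k) [s, t])) r =
      (if r = s then 1 else 0) + ((if s \<otimes> r \<otimes> s = t then 1 else 0) +
        nref (concat (replicate k [s, t])) (t \<otimes> (s \<otimes> r \<otimes> s) \<otimes> t))" by simp
  also have "\<dots> = ?f 0 + (?f 1 + (\<Sum>i<2*k. ?f (Suc (Suc i))))"
    unfolding Suc.IH[OF c(2)] e1 e2 using assms by simp
  also have "\<dots> = (\<Sum>i<2 * Suc k. ?f i)"
    by (simp only: mult_Suc_right numeral_2_eq_2 add_Suc add_0 sum.lessThan_Suc_shift One_nat_def)
  finally show ?case .
qed

text \<open>With \<open>m\<close> the order of \<open>s t\<close>, the elements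
  \<open>(s t)^i s\<close> repeat with period \<open>m\<close>, so the \<open>2 m\<close> letters of
  the relator fall into two halves with equal counts. For infinite order \<open>m = 0\<close> and
  the word is empty.\<close>

lemma nref_relator_even:
  assumes "s \<in> S" "t \<in> S" "r \<in> carrier G"
  shows "even (nref (concat (replicate (ord (s \<otimes> t)) [s, t])) r)"
proof -
  let ?p = "s \<otimes> t" and ?m = "ord (s \<otimes> t)"
  let ?f = "\<lambda>i::nat. if r = ?p [^] i \<otimes> s then 1 else (0::nat)"
  have "?p [^] (?m + i) = ?p [^] i" for i
    using assms nat_pow_mult[of ?p ?m i, symmetric] by simp
  then have "(\<Sum>i<?m. ?f (?m + i)) = (\<Sum>i<?m. ?f i)" by simp
  moreover have "(\<Sum>i<?m + n. ?f i) = (\<Sum>i<?m. ?f i) + (\<Sum>i<n. ?f (?m + i))" for n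
    by (induction n) auto
  ultimately have "(\<Sum>i<2 * ?m. ?f i) = 2 * (\<Sum>i<?m. ?f i)" by (simp add: mult_2)
  then show ?thesis using nref_relator_sum[OF assms(1,2,3), of ?m] by simp
qed

lemma relator_one:
  assumes "s \<in> S" "t \<in> S"
  shows "wp (concat (replicate (ord (s \<otimes> t)) [s, t])) = \<one>"
proof -
  have "wp (concat (replicate k [s, t])) = (s \<otimes> t) [^] k" for k
  proof (induction k)
    case (Suc k)
    then show ?case using nat_pow_Suc2[of "s \<otimes> t" k] assms by (simp add: m_assoc)
  qed simp
  then show ?thesis using assms by simp
qed

lemma relator_lists: "\<lbrakk>s \<in> S; t \<in> S\<rbrakk> \<Longrightarrow> concat (replicate k [s, t]) \<in> lists S"
  by (induction k) auto

lemma coxeter_step_nref: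
  assumes "coxeter_step G S u v" "r \<in> carrier G"
  shows "even (nref u r) = even (nref v r)"
  using assms(1)
proof cases
  case (1 u' v' s t)
  have c: "inv (wp u') \<otimes> r \<otimes> wp u' \<in> carrier G" using 1 assms by simp
  show ?thesis unfolding 1
    using 1(3-6) assms(2) c nref_relator_even[OF 1(5,6) c]
    by (simp add: nref_append relator_lists relator_one)
qed

text \<open>Inserting and deleting relators preserves the parity, so it is a function of the group
  element. The presentation enters the development only here.\<close>

lemma nref_parity:
  assumes "u \<in> lists S" "v \<in> lists S" "wp u = wp v" "r \<in> carrier G"
  shows "even (nref u r) = even (nref v r)"
proof -
  have "equivclp (coxeter_step G S) u v" using presentation assms by blast
  then show ?thesis
  proof (induction rule: equivclp_induct)
    case (step y z)
    then show ?case using coxeter_step_nref[of y z, OF _ assms(4)] coxeter_step_nref[of z y, OF _ assms(4)]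
      by auto
  qed simp
qed

definition reflections :: "'a set" where
  "reflections = {x \<otimes> s \<otimes> inv x |x s. x \<in> carrier G \<and> s \<in> S}"

lemma reflectionE:
  assumes "t \<in> reflections"
  obtains x s where "x \<in> carrier G" "s \<in> S" "t = x \<otimes> s \<otimes> inv x"
  using assms unfolding reflections_def by blast

lemma gen_reflection: "\<lbrakk>x \<in> carrier G; s \<in> S\<rbrakk> \<Longrightarrow> x \<otimes> s \<otimes> inv x \<in> reflections"
  unfolding reflections_def by blast

lemma reflection_closed [simp]: "t \<in> reflections \<Longrightarrow> t \<in> carrier G"
  by (erule reflectionE) simp

lemma reflection_square [simp]: "t \<in> reflections \<Longrightarrow> t \<otimes> t = \<one>"
  by (erule reflectionE) (simp add: m_assoc)

lemma reflection_mult_cancel [simp]: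
  "\<lbrakk>t \<in> reflections; y \<in> carrier G\<rbrakk> \<Longrightarrow> t \<otimes> (t \<otimes> y) = y"
  by (metis reflection_closed reflection_square l_one m_assoc)

text \<open>In the word \<open>v s (rev v)\<close> of \<open>t\<close> the two outer parts together
  have even count, because \<open>v @ rev v\<close> has product one, and the middle letter adds
  one.\<close>

lemma nref_reflection:
  assumes "t \<in> reflections" "u \<in> lists S" "wp u = t"
  shows "odd (nref u t)"
proof -
  obtain x s where x: "x \<in> carrier G" "s \<in> S" "t = x \<otimes> s \<otimes> inv x"
    using assms by (auto elim: reflectionE)
  obtain v where v: "v \<in> lists S" "wp v = x" using word_exists x by blast
  have rv: "rev v \<in> lists S" using v by auto
  have tc: "t \<in> carrier G" using assms by simp
  have e: "inv x \<otimes> t \<otimes> x = s" using x by (simp add: m_assoc)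
  have "even (nref (v @ rev v) t) = even (nref [] t)"
    by (rule nref_parity) (use v rv tc in \<open>auto simp: word_prod_rev\<close>)
  then have a: "even (nref v t + nref (rev v) s)"
    using v tc e by (simp add: nref_append)
  have "wp (v @ s # rev v) = t" using v rv x by (simp add: word_prod_rev m_assoc)
  then have "even (nref u t) = even (nref (v @ s # rev v) t)"
    by (intro nref_parity) (use v rv assms x in auto)
  also have "nref (v @ s # rev v) t = nref v t + (1 + nref (rev v) s)"
    using v tc e x by (simp add: nref_append)
  finally show ?thesis using a by simp
qed

text \<open>A counted prefix \<open>p s\<close> satisfies \<open>t = p s p^-1\<close>, so
  multiplying by \<open>t\<close> on the left cancels exactly that letter.\<close>

lemma nref_pos_delete:
  "\<lbrakk>u \<in> lists S; t \<in> carrier G; nref u t \<noteq> 0\<rbrakk> \<Longrightarrow>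
    \<exists>a s b. u = a @ s # b \<and> t \<otimes> wp u = wp (a @ b)"
proof (induction u arbitrary: t)
  case (Cons s u)
  show ?case
  proof (cases "t = s")
    case True
    then show ?thesis using Cons by (intro exI[of _ "[]"] exI[of _ s] exI[of _ u]) auto
  next
    case False
    then obtain a s' b where "u = a @ s' # b" "(s \<otimes> t \<otimes> s) \<otimes> wp u = wp (a @ b)"
      using Cons.IH[of "s \<otimes> t \<otimes> s"] Cons.prems by auto
    then have "s # u = (s # a) @ s' # b" "s \<otimes> ((s \<otimes> t \<otimes> s) \<otimes> wp u) = wp ((s # a) @ b)" by auto
    moreover have "s \<otimes> ((s \<otimes> t \<otimes> s) \<otimes> wp u) = t \<otimes> wp (s # u)"
      using Cons.prems by (simp add: m_assoc)
    ultimately show ?thesis by metis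
  qed
qed simp

lemma odd_nref_shorter:
  assumes "x \<in> carrier G" "t \<in> carrier G" "u \<in> lists S" "wp u = x" "odd (nref u t)"
  shows "len (t \<otimes> x) < len x"
proof -
  obtain v where v: "reduced_expression G S v x" using reduced_exists assms by blast
  then have "odd (nref v t)" using nref_parity[of u v t] assms by (auto simp: reduced_expression_def)
  then have "nref v t \<noteq> 0" by (metis even_zero)
  then obtain a s b where "v = a @ s # b" "t \<otimes> x = wp (a @ b)"
    using nref_pos_delete[of v t] v assms by (auto simp: reduced_expression_def)
  then show ?thesis using v cox_length_le[of "a @ b"] by (auto simp: reduced_expression_def)
qed

text \<open>Passing from \<open>x\<close> to \<open>t x\<close> adds the odd count of a word for
  \<open>t\<close> and flips the parity. Hence the even case for \<open>x\<close> is the odd case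
  for \<open>t x\<close>.\<close>

lemma reflection_length_cases:
  assumes "t \<in> reflections" "x \<in> carrier G" "u \<in> lists S" "wp u = x"
  shows "if odd (nref u t) then len (t \<otimes> x) < len x else len x < len (t \<otimes> x)"
proof (cases "odd (nref u t)")
  case True
  then show ?thesis using odd_nref_shorter assms reflection_closed by auto
next
  case False
  obtain v where v: "v \<in> lists S" "wp v = t" using word_exists assms reflection_closed by blast
  have "nref (v @ u) t = nref v t + nref u t"
    using v assms by (simp add: nref_append)
  then have "odd (nref (v @ u) t)" using False nref_reflection[OF assms(1) v] by simp
  then have "len (t \<otimes> (t \<otimes> x)) < len (t \<otimes> x)"
    using odd_nref_shorter[of "t \<otimes> x" t "v @ u"] assms v by simp
  then show ?thesis using False assms by simp
qed

lemma strong_exchange: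
  assumes "t \<in> reflections" "u \<in> lists S" "len (t \<otimes> wp u) < len (wp u)"
  shows "\<exists>a s b. u = a @ s # b \<and> t \<otimes> wp u = wp (a @ b)"
proof -
  have "odd (nref u t)"
    using reflection_length_cases[OF assms(1) _ assms(2) refl] assms by (auto split: if_splits)
  then have "nref u t \<noteq> 0" by (metis even_zero)
  then show ?thesis using nref_pos_delete assms by simp
qed

lemma conj_gen_mult: "\<lbrakk>x \<in> carrier G; s \<in> S\<rbrakk> \<Longrightarrow> (x \<otimes> s \<otimes> inv x) \<otimes> x = x \<otimes> s"
  by (simp add: m_assoc)

text \<open>Right multiplication by \<open>s\<close> is left multiplication by the reflection
  \<open>x s x^-1\<close>, so the strong exchange property applies.\<close>

lemma right_exchange:
  assumes "s \<in> S" "u \<in> lists S" "len (wp u \<otimes> s) < len (wp u)"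
  shows "\<exists>a s' b. u = a @ s' # b \<and> wp u \<otimes> s = wp (a @ b)"
  using strong_exchange[OF gen_reflection[of "wp u" s] assms(2)] assms
  by (simp add: conj_gen_mult)

lemma cox_length_mult_gen_cases:
  assumes "x \<in> carrier G" "s \<in> S"
  shows "len (x \<otimes> s) = len x + 1 \<or> len x = len (x \<otimes> s) + 1"
proof -
  obtain u where "u \<in> lists S" "wp u = x" using word_exists assms by blast
  then have "len (x \<otimes> s) \<noteq> len x"
    using reflection_length_cases[OF gen_reflection[OF assms], of x u] assms
    by (auto simp: conj_gen_mult split: if_splits)
  then show ?thesis
    using cox_length_mult_gen_le[OF assms] cox_length_le_mult_gen[OF assms] by linarith
qed

subsection \<open>Bruhat order and Demazure product\<close>

definition bruhat_step :: "'a \<Rightarrow> 'a \<Rightarrow> bool" where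
  "bruhat_step x y \<longleftrightarrow> x \<in> carrier G \<and> (\<exists>t\<in>reflections. y = t \<otimes> x) \<and> len x < len y"

abbreviation bruhat :: "'a \<Rightarrow> 'a \<Rightarrow> bool" where "bruhat \<equiv> bruhat_step\<^sup>*\<^sup>*"

lemma bruhat_length: "bruhat x y \<Longrightarrow> x = y \<or> len x < len y"
  by (induction rule: rtranclp_induct) (auto simp: bruhat_step_def)

lemma bruhat_mult_gen: "\<lbrakk>x \<in> carrier G; s \<in> S; len x < len (x \<otimes> s)\<rbrakk> \<Longrightarrow> bruhat_step x (x \<otimes> s)"
  unfolding bruhat_step_def using gen_reflection conj_gen_mult by metis

definition dmult :: "'a \<Rightarrow> 'a \<Rightarrow> 'a" where
  "dmult x s = (if len x < len (x \<otimes> s) then x \<otimes> s else x)"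

lemma dmult_closed [simp]: "\<lbrakk>x \<in> carrier G; s \<in> S\<rbrakk> \<Longrightarrow> dmult x s \<in> carrier G"
  by (simp add: dmult_def)

lemma bruhat_dmult: 
  assumes "x \<in> carrier G" "s \<in> S"
  shows "bruhat x (dmult x s)" "bruhat (x \<otimes> s) (dmult x s)"
proof -
  show "bruhat x (dmult x s)" using bruhat_mult_gen[OF assms] by (auto simp: dmult_def)
  have "len (x \<otimes> s) < len x" if "\<not> len x < len (x \<otimes> s)"
    using that cox_length_mult_gen_cases[OF assms] by linarith
  then show "bruhat (x \<otimes> s) (dmult x s)"
    using bruhat_mult_gen[of "x \<otimes> s" s] assms by (auto simp: dmult_def)
qed

lemma bruhat_step_dmult_mono:
  assumes "bruhat_step x y" "s \<in> S"
  shows "bruhat (dmult x s) (dmult y s)"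
proof -
  obtain t where t: "t \<in> reflections" "y = t \<otimes> x" "x \<in> carrier G" "len x < len y"
    using assms by (auto simp: bruhat_step_def)
  have y: "y \<in> carrier G" using t by simp
  show ?thesis
  proof (cases "y = x \<otimes> s")
    case True
    then have "dmult x s = y" using t by (simp add: dmult_def)
    then show ?thesis using bruhat_dmult[OF y assms(2)] by simp
  next
    case False
    obtain u where u: "reduced_expression G S u x" using reduced_exists t by blast
    have us: "u @ [s] \<in> lists S" "wp (u @ [s]) = x \<otimes> s" "u \<in> lists S" "wp u = x"
      using u t assms by (auto simp: reduced_expression_def)
    \<comment> \<open>If \<open>t\<close> shortened \<open>x s\<close>, exchange would delete a
      letter of the word \<open>u @ [s]\<close>. Deleting the last one forces
      \<open>y = x s\<close>; deleting one of \<open>u\<close> writes \<open>y\<close> with fewer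
      than \<open>len x\<close> letters.\<close>
    have "len (x \<otimes> s) < len (t \<otimes> (x \<otimes> s))"
    proof (rule ccontr)
      assume "\<not> ?thesis"
      then have "len (t \<otimes> wp (u @ [s])) < len (wp (u @ [s]))"
        using reflection_length_cases[OF t(1) _ us(1) us(2)] t us assms by (auto split: if_splits)
      from strong_exchange[OF t(1) us(1) this] obtain a s' b
        where ab: "u @ [s] = a @ s' # b" "t \<otimes> (x \<otimes> s) = wp (a @ b)" using us by auto
      show False
      proof (cases b rule: rev_cases)
        case Nil
        then have "t \<otimes> (x \<otimes> s) = x" using ab us by simp
        then have "t \<otimes> (t \<otimes> (x \<otimes> s)) = y" using t by simp
        then show False using False t assms by simp
      next
        case (snoc b' z)
        then have z: "z = s" "u = a @ s' # b'" using ab by auto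
        have "t \<otimes> x \<otimes> s = wp (a @ b') \<otimes> s"
          using ab(2) z snoc us assms t by (auto simp: m_assoc)
        then have "t \<otimes> x \<otimes> s \<otimes> s = wp (a @ b') \<otimes> s \<otimes> s" by simp
        then have "y = wp (a @ b')" using t us z assms by simp
        then have "len y \<le> length (a @ b')" using cox_length_le[of "a @ b'"] us z by auto
        then show False using t u z by (auto simp: reduced_expression_def)
      qed
    qed
    then have "bruhat_step (x \<otimes> s) (y \<otimes> s)"
      using t assms unfolding bruhat_step_def by (auto simp: m_assoc)
    then have "bruhat (x \<otimes> s) (dmult y s)" "bruhat x (dmult y s)"
      using bruhat_dmult[OF y assms(2)] assms(1) by (meson converse_rtranclp_into_rtranclp)+
    then show ?thesis by (simp add: dmult_def[of x])
  qed
qed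

lemma bruhat_dmult_mono: "\<lbrakk>bruhat x y; s \<in> S\<rbrakk> \<Longrightarrow> bruhat (dmult x s) (dmult y s)"
  by (induction rule: rtranclp_induct) (auto intro: rtranclp_trans bruhat_step_dmult_mono)

section \<open>Demazure products and reduced subwords\<close>

definition dem :: "'a list \<Rightarrow> 'a" where "dem Q = foldl dmult \<one> Q"

lemma dem_Nil [simp]: "dem [] = \<one>" and dem_snoc [simp]: "dem (Q @ [s]) = dmult (dem Q) s"
  by (simp_all add: dem_def)

lemma dem_closed [simp]: "Q \<in> lists S \<Longrightarrow> dem Q \<in> carrier G"
  by (induction Q rule: rev_induct) auto

definition subs :: "'a list \<Rightarrow> 'a set" where
  "subs Q = {x. \<exists>w. subseq w Q \<and> reduced_expression G S w x}"

lemma subs_closed: "x \<in> subs Q \<Longrightarrow> x \<in> carrier G"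
  by (auto simp: subs_def reduced_expression_def)

lemma subs_mono: "subseq P Q \<Longrightarrow> subs P \<subseteq> subs Q"
  unfolding subs_def by (blast intro: subseq_order.order_trans)

lemma reduced_snoc:
  assumes "reduced_expression G S (u @ [s]) x"
  shows "reduced_expression G S u (x \<otimes> s)" "len (x \<otimes> s) < len x" "s \<in> S"
proof -
  have u: "u \<in> lists S" "s \<in> S" "x = wp u \<otimes> s" "length u + 1 = len x"
    using assms by (auto simp: reduced_expression_def)
  then have xs: "x \<otimes> s = wp u" by simp
  have "len (wp u) \<le> length u" "len x \<le> len (wp u) + 1"
    using u cox_length_le cox_length_mult_gen_le[of "wp u" s] by auto
  with u xs show "reduced_expression G S u (x \<otimes> s)" "len (x \<otimes> s) < len x" "s \<in> S"
    by (auto simp: reduced_expression_def)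
qed

lemma reduced_snocI:
  assumes "reduced_expression G S u (x \<otimes> s)" "len (x \<otimes> s) < len x" "s \<in> S" "x \<in> carrier G"
  shows "reduced_expression G S (u @ [s]) x"
  using assms cox_length_mult_gen_cases[OF assms(4,3)] by (auto simp: reduced_expression_def)

lemma subs_Nil: "subs [] = {\<one>}"
  by (auto simp: subs_def reduced_expression_def dest: list_emb_Nil2)

text \<open>This is the deletion property. A further letter \<open>s\<close> either extends the
  chosen reduced subword, or, at a descent, exchange removes one of its letters and \<open>s\<close>
  is left out.\<close>

lemma reduced_subseq_exists:
  "u \<in> lists S \<Longrightarrow> \<exists>v. subseq v u \<and> reduced_expression G S v (wp u)"
proof (induction u rule: rev_induct)
  case Nil
  then show ?case by (auto simp: reduced_expression_def)
next
  case (snoc s u)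
  then obtain v where v: "subseq v u" "reduced_expression G S v (wp u)" by auto
  have vS: "v \<in> lists S" "wp v = wp u" "length v = len (wp u)" using v by (auto simp: reduced_expression_def)
  have us: "wp u \<in> carrier G" "s \<in> S" using snoc by auto
  show ?case
  proof (cases "len (wp u) < len (wp u \<otimes> s)")
    case True
    then have "reduced_expression G S (v @ [s]) (wp u \<otimes> s)"
      using reduced_snocI[of v "wp u \<otimes> s" s] v us by simp
    then show ?thesis using v snoc by (intro exI[of _ "v @ [s]"]) (auto intro: list_emb_append_mono)
  next
    case False
    then have l: "len (wp u) = len (wp u \<otimes> s) + 1" using cox_length_mult_gen_cases[OF us] by auto
    then obtain a s' b where ab: "v = a @ s' # b" "wp v \<otimes> s = wp (a @ b)"
      using right_exchange[of s v] vS us by auto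
    have "reduced_expression G S (a @ b) (wp u \<otimes> s)"
      using ab vS l us by (auto simp: reduced_expression_def)
    moreover have "subseq (a @ b) v" using ab by (simp add: list_emb_append_mono subseq_Cons')
    then have "subseq (a @ b) (u @ [s])" using v(1)
      by (meson subseq_order.order_trans subseq_rev_drop_many list_emb_append2)
    ultimately show ?thesis using snoc by (intro exI[of _ "a @ b"]) auto
  qed
qed

lemma subs_descent:
  assumes "x \<in> subs Q" "s \<in> S" "len (x \<otimes> s) < len x"
  shows "x \<otimes> s \<in> subs Q"
proof -
  obtain w where w: "subseq w Q" "w \<in> lists S" "wp w = x" "length w = len x"
    using assms by (auto simp: subs_def reduced_expression_def)
  obtain a s' b where ab: "w = a @ s' # b" "x \<otimes> s = wp (a @ b)"
    using right_exchange[of s w] w assms by auto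
  obtain v where "subseq v (a @ b)" "reduced_expression G S v (x \<otimes> s)"
    using reduced_subseq_exists[of "a @ b"] ab w by auto
  moreover have "subseq (a @ b) w" using ab by (simp add: list_emb_append_mono subseq_Cons')
  ultimately show ?thesis using w(1) unfolding subs_def
    by (blast intro: subseq_order.order_trans)
qed

text \<open>At a descent, an expression of \<open>x\<close> that avoids the last letter can be
  exchanged for one of \<open>x s\<close>, so only \<open>x s\<close> has to be tested. Otherwise no
  reduced expression of \<open>x\<close> ends in \<open>s\<close>. The recursions for subword
  complexes rest on this.\<close>

lemma subs_snoc:
  assumes "s \<in> S" "x \<in> carrier G"
  shows "x \<in> subs (Q @ [s]) \<longleftrightarrow> (if len (x \<otimes> s) < len x then x \<otimes> s \<in> subs Q else x \<in> subs Q)"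
proof -
  have "x \<in> subs (Q @ [s]) \<longleftrightarrow> x \<in> subs Q \<or> (len (x \<otimes> s) < len x \<and> x \<otimes> s \<in> subs Q)"
  proof
    assume "x \<in> subs (Q @ [s])"
    then obtain w where w: "subseq w (Q @ [s])" "reduced_expression G S w x" by (auto simp: subs_def)
    then obtain a b where ab: "w = a @ b" "subseq a Q" "subseq b [s]"
      by (meson subseq_appendE)
    then have "b = [] \<or> b = [s]" by (cases b) (auto split: if_splits elim: list_emb.cases)
    then show "x \<in> subs Q \<or> (len (x \<otimes> s) < len x \<and> x \<otimes> s \<in> subs Q)"
      using w(2) ab reduced_snoc[of a s x] by (auto simp: subs_def)
  next
    assume "x \<in> subs Q \<or> (len (x \<otimes> s) < len x \<and> x \<otimes> s \<in> subs Q)"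
    then show "x \<in> subs (Q @ [s])"
    proof
      assume "x \<in> subs Q"
      then show ?thesis using subs_mono[of Q "Q @ [s]"] by auto
    next
      assume a: "len (x \<otimes> s) < len x \<and> x \<otimes> s \<in> subs Q"
      then obtain w where "subseq w Q" "reduced_expression G S w (x \<otimes> s)" by (auto simp: subs_def)
      then have "subseq (w @ [s]) (Q @ [s])" "reduced_expression G S (w @ [s]) x"
        using a assms reduced_snocI by (auto intro: list_emb_append_mono)
      then show ?thesis unfolding subs_def by blast
    qed
  qed
  then show ?thesis using subs_descent[OF _ assms(1)] by auto
qed

lemma dem_in_subs: "Q \<in> lists S \<Longrightarrow> dem Q \<in> subs Q"
proof (induction Q rule: rev_induct)
  case (snoc s Q)
  then have "dem Q \<in> subs Q" "dem Q \<in> carrier G" "s \<in> S" by auto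
  moreover have "subs Q \<subseteq> subs (Q @ [s])" by (rule subs_mono) (rule list_emb_prefix, simp)
  moreover have "dem Q \<otimes> s \<in> subs (Q @ [s])" if "len (dem Q) < len (dem Q \<otimes> s)"
    using that calculation by (simp add: subs_snoc)
  ultimately show ?case by (auto simp: dmult_def)
qed (simp add: subs_Nil)

text \<open>At a descent the induction hypothesis compares \<open>x s\<close> with
  \<open>dem Q\<close>, and monotonicity of \<open>dmult\<close> carries this to \<open>x\<close>
  and \<open>dem (Q @ [s])\<close>.\<close>

lemma subs_bruhat_dem: "\<lbrakk>Q \<in> lists S; x \<in> subs Q\<rbrakk> \<Longrightarrow> bruhat x (dem Q)"
proof (induction Q arbitrary: x rule: rev_induct)
  case (snoc s Q)
  have c: "x \<in> carrier G" "s \<in> S" "Q \<in> lists S" "dem Q \<in> carrier G"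
    using snoc subs_closed by auto
  show ?case
  proof (cases "len (x \<otimes> s) < len x")
    case True
    then have "bruhat (x \<otimes> s) (dem Q)" using snoc c by (simp add: subs_snoc)
    then have "bruhat (dmult (x \<otimes> s) s) (dmult (dem Q) s)" using c bruhat_dmult_mono by blast
    then show ?thesis using True c by (simp add: dmult_def)
  next
    case False
    then have "bruhat x (dem Q)" using snoc c by (simp add: subs_snoc)
    then show ?thesis using bruhat_dmult[OF c(4,2)] by simp
  qed
qed (simp add: subs_Nil)

text \<open>Since \<open>dem Q\<close> itself lies in \<open>subs Q\<close>, it is the unique
  longest element there. From here on this is all that is used of the Bruhat order.\<close>

lemma subs_length: "\<lbrakk>Q \<in> lists S; x \<in> subs Q\<rbrakk> \<Longrightarrow> x = dem Q \<or> len x < len (dem Q)"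
  using subs_bruhat_dem bruhat_length by blast

lemma dmult_descent: "\<lbrakk>x \<in> carrier G; s \<in> S\<rbrakk> \<Longrightarrow> len (dmult x s \<otimes> s) < len (dmult x s)"
  using cox_length_mult_gen_cases[of x s] by (auto simp: dmult_def)

lemma dmult_eq_iff:
  assumes "x \<in> carrier G" "y \<in> carrier G" "s \<in> S" "len (y \<otimes> s) < len y"
  shows "dmult x s = y \<longleftrightarrow> x = y \<or> x = y \<otimes> s"
  using assms by (auto simp: dmult_def)

lemma dem_reduced:
  assumes "reduced_expression G S u x" shows "dem u = x"
proof -
  have u: "u \<in> lists S" "length u = len x" using assms by (auto simp: reduced_expression_def)
  obtain v where v: "subseq v u" "reduced_expression G S v (dem u)"
    using dem_in_subs[OF u(1)] by (auto simp: subs_def)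
  then have "len (dem u) \<le> len x"
    using u list_emb_length[OF v(1)] by (auto simp: reduced_expression_def)
  moreover have "x \<in> subs u" using assms by (auto simp: subs_def)
  ultimately show ?thesis using subs_length[OF u(1), of x] by auto
qed

subsection \<open>The longest element\<close>

text \<open>If every generator is a descent of \<open>x\<close>, then \<open>dmult x s = x\<close>
  throughout. Appending a word of \<open>y\<close> to a word of \<open>x\<close> therefore leaves
  the Demazure product \<open>x\<close>, while \<open>y\<close> is an element of \<open>subs\<close>
  of the longer word.\<close>

lemma all_descents_max:
  assumes x: "x \<in> carrier G" "\<And>s. s \<in> S \<Longrightarrow> len (x \<otimes> s) < len x" and y: "y \<in> carrier G"
  shows "y = x \<or> len y < len x"
proof -
  obtain u w where u: "reduced_expression G S u x" and w: "reduced_expression G S w y"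
    using reduced_exists[OF x(1)] reduced_exists[OF y] by blast
  have uw: "u \<in> lists S" "w \<in> lists S" using u w by (auto simp: reduced_expression_def)
  have "dem (u @ w) = x" using uw(2)
  proof (induction w rule: rev_induct)
    case Nil then show ?case using dem_reduced[OF u] by simp
  next
    case (snoc s w)
    then have "dem ((u @ w) @ [s]) = x" using x(2)[of s] by (subst dem_snoc) (simp add: dmult_def)
    then show ?case by simp
  qed
  moreover have "y \<in> subs (u @ w)" using w by (auto simp: subs_def)
  ultimately show ?thesis using subs_length[of "u @ w" y] uw by simp
qed

context
  assumes fin: "finite (carrier G)"
begin

abbreviation w0 :: 'a where "w0 \<equiv> longest_element G S"

lemma longest_element_max:
  "w0 \<in> carrier G \<and> (\<forall>y\<in>carrier G. y = w0 \<or> len y < len w0)"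
proof -
  let ?P = "\<lambda>x. x \<in> carrier G \<and> (\<forall>y\<in>carrier G. len y \<le> len x)"
  have "Max (len ` carrier G) \<in> len ` carrier G" using fin by (intro Max_in) auto
  then obtain x where x: "x \<in> carrier G" "len x = Max (len ` carrier G)" by auto
  then have P: "?P x" using fin by auto
  have "len (x \<otimes> s) < len x" if "s \<in> S" for s
  proof -
    have "len (x \<otimes> s) \<le> len x" using P that by simp
    then show ?thesis using x that cox_length_mult_gen_cases[of x s] by linarith
  qed
  then have max: "y = x \<or> len y < len x" if "y \<in> carrier G" for y
    using all_descents_max[OF x(1) _ that] by blast
  have "w0 = x" unfolding longest_element_def
    by (rule the_equality) (use P max x(1) in \<open>auto simp: not_less[symmetric]\<close>)
  then show ?thesis using x max by blast
qed

lemma longest_closed [simp]: "w0 \<in> carrier G"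
  using longest_element_max by blast

lemma longest_unique: "y \<in> carrier G \<Longrightarrow> y = w0 \<or> len y < len w0"
  using longest_element_max by blast

text \<open>By \<open>all_descents_max\<close> every element other than \<open>w0\<close> has an
  ascent, and \<open>R\<close> collects such ascents.\<close>

lemma longest_extend:
  "x \<in> carrier G \<Longrightarrow> \<exists>R\<in>lists S. x \<otimes> wp R = w0 \<and> len x + length R = len w0"
proof (induction "len w0 - len x" arbitrary: x rule: less_induct)
  case less
  show ?case
  proof (cases "x = w0")
    case True
    then show ?thesis by (intro bexI[of _ "[]"]) auto
  next
    case False
    then have lt: "len x < len w0" using longest_unique[OF less.prems] by blast
    have "\<not> (\<forall>s\<in>S. len (x \<otimes> s) < len x)"
    proof
      assume "\<forall>s\<in>S. len (x \<otimes> s) < len x"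
      then have "w0 = x \<or> len w0 < len x" by (intro all_descents_max[OF less.prems]) auto
      then show False using False lt by auto
    qed
    then obtain s where s: "s \<in> S" "\<not> len (x \<otimes> s) < len x" by blast
    then have l: "len (x \<otimes> s) = len x + 1" using cox_length_mult_gen_cases[OF less.prems s(1)] by auto
    then obtain R where "R \<in> lists S" "x \<otimes> s \<otimes> wp R = w0" "len (x \<otimes> s) + length R = len w0"
      using less.hyps[of "x \<otimes> s"] lt less.prems s diff_less_mono2[of "len x" "len (x \<otimes> s)" "len w0"] by auto
    then show ?thesis using l s less.prems by (intro bexI[of _ "s # R"]) (auto simp: m_assoc)
  qed
qed

lemma dem_eq_longest:
  assumes "Q \<in> lists S" "w0 \<in> subs Q" shows "dem Q = w0"
proof (rule ccontr)
  assume "dem Q \<noteq> w0"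
  then show False using subs_length[OF assms] longest_unique[OF dem_closed[OF assms(1)]] by auto
qed

section \<open>Coxeter elements and their sorting words\<close>

lemma gens_finite: "finite S"
  using fin gens_subset finite_subset by blast

lemma gen_in_support:
  assumes "s \<in> S" "u \<in> lists S" "wp u = s" shows "s \<in> set u"
proof -
  obtain v where v: "subseq v u" "reduced_expression G S v s"
    using reduced_subseq_exists assms by blast
  then have "length v = 1" using cox_length_gen assms by (simp add: reduced_expression_def)
  then obtain s' where "v = [s']" by (auto simp: length_Suc_conv)
  then show ?thesis using v by (auto simp: reduced_expression_def subseq_singleton_left)
qed

text \<open>The reduced word \<open>cw\<close> is not given as an ordering of \<open>S\<close>. With
  \<open>w = a @ s # b\<close>, the generator \<open>s\<close> is the product of
  \<open>rev a\<close>, \<open>cw\<close> and \<open>rev b\<close>, so it occurs in one of them, and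
  distinctness of \<open>w\<close> excludes the outer two.\<close>

lemma coxeter_element_support:
  assumes "coxeter_element G S c" "reduced_expression G S cw c" shows "set cw = S"
proof
  show "set cw \<subseteq> S" using assms by (auto simp: reduced_expression_def lists_eq_set)
next
  obtain w where w: "distinct w" "set w = S" "wp w = c"
    using assms by (auto simp: coxeter_element_def)
  have cw: "cw \<in> lists S" "wp cw = c" using assms by (auto simp: reduced_expression_def)
  show "S \<subseteq> set cw"
  proof
    fix s assume s: "s \<in> S"
    then obtain a b where ab: "w = a @ s # b" using w by (auto dest: split_list)
    have l: "a \<in> lists S" "b \<in> lists S" using ab w by (auto simp: lists_eq_set)
    have "wp cw = wp a \<otimes> (s \<otimes> wp b)" using l cw w ab s by simp
    then have "wp (rev a @ cw @ rev b) = inv (wp a) \<otimes> (wp a \<otimes> (s \<otimes> wp b)) \<otimes> inv (wp b)"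
      using l cw s by (simp add: word_prod_rev m_assoc)
    also have "\<dots> = s" using l s by (simp add: m_assoc)
    finally have "s \<in> set (rev a @ cw @ rev b)"
      by (intro gen_in_support[OF s]) (use l cw in auto)
    then show "s \<in> set cw" using ab w by auto
  qed
qed

lemma reduced_c_sorting_word:
  assumes cw: "set cw = S"
  shows "reduced_expression G S (c_sorting_word G S cw) w0"
proof -
  let ?X = "longest_positions G S cw" and ?r = "{(i, j::nat). i < j}"
  let ?P = "\<lambda>ps. ps \<in> ?X \<and> (\<forall>qs\<in>?X. qs \<noteq> ps \<longrightarrow> (ps, qs) \<in> lexord ?r)"
  obtain r where r: "reduced_expression G S r w0" using reduced_exists[OF longest_closed] by blast
  have "\<forall>s\<in>set r. \<exists>j. j < length cw \<and> cw ! j = s"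
    using r cw unfolding reduced_expression_def lists_eq_set by (metis in_set_conv_nth mem_Collect_eq subsetD subsetI)
  then obtain f where f: "\<And>s. s \<in> set r \<Longrightarrow> f s < length cw \<and> cw ! f s = s" by metis
  \<comment> \<open>The letter of \<open>r\<close> at index \<open>i\<close> is taken from the copy
    of \<open>cw\<close> with index \<open>i\<close>, which makes the positions increase.\<close>
  define ps0 where "ps0 = map (\<lambda>i. i * length cw + f (r ! i)) [0..<length r]"
  have "sorted_wrt (<) ps0"
  proof -
    have "i * length cw + f (r ! i) < j * length cw + f (r ! j)" if "i < j" "j < length r" for i j
    proof -
      have "i * length cw + f (r ! i) < Suc i * length cw" using f[of "r ! i"] that by simp
      also have "\<dots> \<le> j * length cw" using that by (intro mult_le_mono1) simp
      finally show ?thesis by simp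
    qed
    then show ?thesis by (simp add: ps0_def sorted_wrt_iff_nth_less)
  qed
  moreover have "map (\<lambda>i. cw ! (i mod length cw)) ps0 = r"
    by (rule nth_equalityI) (use f in \<open>auto simp: ps0_def\<close>)
  ultimately have ne: "ps0 \<in> ?X" using r by (simp add: longest_positions_def)
  have len: "length ps = len w0" if "ps \<in> ?X" for ps
    using that by (auto simp: longest_positions_def reduced_expression_def)
  \<comment> \<open>All sequences in \<open>?X\<close> have length \<open>len w0\<close>. On lists
    of one length \<open>lexord\<close> agrees with \<open>lex\<close>, which is well-founded, so a
    first sequence exists and the description in \<open>c_sorting_word\<close> has a value.\<close>
  have "wf ?r" using wf_less by simp
  then have "wf (lex ?r)" by (rule wf_lex)
  then obtain ps where ps: "ps \<in> ?X" "\<And>qs. (qs, ps) \<in> lex ?r \<Longrightarrow> qs \<notin> ?X"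
    by (rule wfE_min[OF _ ne]) blast
  have P: "?P ps"
  proof (intro conjI ballI impI)
    fix qs assume qs: "qs \<in> ?X" "qs \<noteq> ps"
    then have "(qs, ps) \<notin> lex ?r" using ps(2) by blast
    then have "(qs, ps) \<notin> lexord ?r" using len[OF qs(1)] len[OF ps(1)] by (simp add: lexord_lex)
    moreover have "(ps, qs) \<in> lexord ?r \<or> ps = qs \<or> (qs, ps) \<in> lexord ?r"
      by (rule lexord_linear) auto
    ultimately show "(ps, qs) \<in> lexord ?r" using qs(2) by blast
  qed (fact ps)
  have irr: "(ps, ps) \<notin> lexord ?r" for ps by (rule lexord_irreflexive) auto
  have tr: "trans (lexord ?r)" by (rule lexord_transI) (auto simp: trans_def)
  have "(THE ps. ?P ps) = ps"
  proof (rule the_equality)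
    show "?P ps" using P .
    fix qs assume qs: "?P qs"
    show "qs = ps"
    proof (rule ccontr)
      assume ne: "qs \<noteq> ps"
      have "(qs, ps) \<in> lexord ?r"
        using bspec[OF conjunct2[OF qs] ps(1)] ne[symmetric] by (rule mp)
      moreover have "(ps, qs) \<in> lexord ?r"
        using bspec[OF conjunct2[OF P] conjunct1[OF qs]] ne by (rule mp)
      ultimately have "(ps, ps) \<in> lexord ?r" using transD[OF tr] by metis
      then show False using irr by metis
    qed
  qed
  then show ?thesis using ps(1) by (simp add: c_sorting_word_def longest_positions_def)
qed

end

lemma subseq_power:
  "w \<in> lists (set cw) \<Longrightarrow> subseq w (concat (replicate (length w) cw))"
proof (induction w)
  case (Cons s w)
  then have "subseq [s] cw" by (auto simp: subseq_singleton_left)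
  then have "subseq ([s] @ w) (cw @ concat (replicate (length w) cw))"
    using Cons by (intro list_emb_append_mono) auto
  then show ?case by simp
qed simp

end

section \<open>Geometric realizations of finite complexes\<close>

definition realization_set :: "'v set set \<Rightarrow> ('v \<Rightarrow> real) set" where
  "realization_set K =
     {x. (\<forall>v. 0 \<le> x v) \<and> {v. x v \<noteq> 0} \<in> K \<and> (\<Sum>v\<in>{v. x v \<noteq> 0}. x v) = 1}"

lemma geometric_realization_eq: "geometric_realization K = top_of_set (realization_set K)"
  unfolding geometric_realization_def realization_set_def by (simp add: euclidean_product_topology)

lemma nsphere_eq: "nsphere n = top_of_set {x. (\<Sum>i\<le>n. x i ^ 2) = 1 \<and> (\<forall>i>n. x i = 0)}"
  unfolding nsphere by (simp add: euclidean_product_topology)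

lemma homeomorphic_space_top_of_set:
  assumes "S homeomorphic T" shows "top_of_set S homeomorphic_space top_of_set T"
proof -
  obtain f g where fg: "homeomorphism S T f g" using assms homeomorphic_def by blast
  then have "homeomorphic_maps (top_of_set S) (top_of_set T) f g"
    by (auto simp: homeomorphic_maps_def homeomorphism_def)
  then show ?thesis by (rule homeomorphic_maps_imp_homeomorphic_space)
qed

abbreviation fin_complex :: "'v set set \<Rightarrow> bool" where
  "fin_complex K \<equiv> abstract_simplicial_complex K \<and> finite K"

lemma complexD: "\<lbrakk>abstract_simplicial_complex K; F \<in> K; F' \<subseteq> F\<rbrakk> \<Longrightarrow> F' \<in> K"
  by (auto simp: abstract_simplicial_complex_def)

lemma complex_finite: "\<lbrakk>abstract_simplicial_complex K; F \<in> K\<rbrakk> \<Longrightarrow> finite F"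
  by (auto simp: abstract_simplicial_complex_def)

lemma complex_empty_in: "\<lbrakk>abstract_simplicial_complex K; K \<noteq> {}\<rbrakk> \<Longrightarrow> {} \<in> K"
  by (auto simp: abstract_simplicial_complex_def)

lemma fin_complex_finite_vertices: "fin_complex K \<Longrightarrow> finite (\<Union>K)"
  by (auto simp: abstract_simplicial_complex_def)

lemma realization_set_iff:
  assumes "finite U" "\<Union>K \<subseteq> U"
  shows "x \<in> realization_set K \<longleftrightarrow> (\<forall>v. 0 \<le> x v) \<and> {v. x v \<noteq> 0} \<in> K \<and> (\<Sum>v\<in>U. x v) = 1"
proof -
  have "(\<Sum>v\<in>{v. x v \<noteq> 0}. x v) = (\<Sum>v\<in>U. x v)" if "{v. x v \<noteq> 0} \<in> K"
    using assms that by (intro sum.mono_neutral_left) auto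
  then show ?thesis unfolding realization_set_def by auto
qed

text \<open>The realization is a finite union of closed simplices inside a cube, which is compact by
  Tychonoff even for an infinite vertex type.\<close>

lemma compact_realization_set:
  fixes K :: "'a set set"
  assumes "fin_complex K" shows "compact (realization_set K)"
proof -
  let ?B = "Pi\<^sub>E UNIV (\<lambda>_. {0..1::real}) :: ('a \<Rightarrow> real) set"
  let ?C = "\<lambda>F :: 'a set. {x. (\<forall>v. 0 \<le> x v) \<and> (\<forall>v. v \<notin> F \<longrightarrow> x v = 0) \<and> (\<Sum>v\<in>F. x v) = (1::real)}"
  have "compact ?B"
    using compactin_PiE[of "\<lambda>_::'a. euclideanreal" UNIV "\<lambda>_. {0..1}"]
    by (simp add: euclidean_product_topology)
  moreover have "closed (?C F)" for F
  proof -
    have "?C F = (\<Inter>v. {x. 0 \<le> x v}) \<inter> (\<Inter>v\<in>-F. {x. x v = 0}) \<inter> {x. (\<Sum>v\<in>F. x v) = 1}" by auto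
    moreover have "closed {x::'a \<Rightarrow> real. 0 \<le> x v}" "closed {x::'a \<Rightarrow> real. x v = 0}" for v
      by (intro closed_Collect_le closed_Collect_eq continuous_on_const continuous_on_product_coordinates)+
    moreover have "closed {x::'a \<Rightarrow> real. (\<Sum>v\<in>F. x v) = 1}"
      by (intro closed_Collect_eq continuous_on_const continuous_on_sum continuous_on_product_coordinates)
    ultimately show ?thesis by (auto intro!: closed_Int closed_INT)
  qed
  then have "closed (\<Union>F\<in>K. ?C F)" using assms by (intro closed_UN) auto
  moreover have "realization_set K = (\<Union>F\<in>K. ?C F)"
  proof (intro equalityI subsetI)
    fix x assume "x \<in> realization_set K"
    then show "x \<in> (\<Union>F\<in>K. ?C F)" unfolding realization_set_def
      by (intro UN_I[of "{v. x v \<noteq> 0}"]) auto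
  next
    fix x assume "x \<in> (\<Union>F\<in>K. ?C F)"
    then obtain F where F: "F \<in> K" "x \<in> ?C F" by blast
    have sub: "{v. x v \<noteq> 0} \<subseteq> F" using F by auto
    moreover have "finite F" using F assms complex_finite by blast
    then have "(\<Sum>v\<in>{v. x v \<noteq> 0}. x v) = (\<Sum>v\<in>F. x v)"
      using sub by (intro sum.mono_neutral_left) auto
    moreover have "{v. x v \<noteq> 0} \<in> K" using sub F assms complexD by blast
    ultimately show "x \<in> realization_set K" using F by (auto simp: realization_set_def)
  qed
  moreover have "(\<Union>F\<in>K. ?C F) \<subseteq> ?B"
  proof
    fix x assume "x \<in> (\<Union>F\<in>K. ?C F)"
    then obtain F where F: "F \<in> K" "x \<in> ?C F" by blast
    then have "finite F" using assms complex_finite by blast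
    then have "x v \<le> 1" for v
      using F member_le_sum[of v F x] by (cases "v \<in> F") auto
    then show "x \<in> ?B" using F by (auto simp: PiE_iff)
  qed
  ultimately show ?thesis by (metis compact_Int_closed inf.absorb2)
qed

subsection \<open>Stellar subdivision\<close>

text \<open>The test \<open>(F - {a}) \<union> \<sigma> \<in> K\<close> says that the face opposite
  to \<open>a\<close> lies in the closed star of \<open>\<sigma>\<close>, without naming the link of
  \<open>\<sigma>\<close>.\<close>

definition stellar :: "'v set \<Rightarrow> 'v \<Rightarrow> 'v set set \<Rightarrow> 'v set set" where
  "stellar \<sigma> a K = {F. \<not> \<sigma> \<subseteq> F \<and> (if a \<in> F then (F - {a}) \<union> \<sigma> \<in> K else F \<in> K)}"

lemma continuous_on_Min:
  fixes f :: "'i \<Rightarrow> 'a::topological_space \<Rightarrow> real"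
  assumes "finite I" "I \<noteq> {}" "\<And>i. i \<in> I \<Longrightarrow> continuous_on S (f i)"
  shows "continuous_on S (\<lambda>x. Min ((\<lambda>i. f i x) ` I))"
  using assms
proof (induction I rule: finite_ne_induct)
  case (insert i I)
  have "(\<lambda>x. Min ((\<lambda>i. f i x) ` insert i I)) = (\<lambda>x. min (f i x) (Min ((\<lambda>i. f i x) ` I)))"
    using insert by (intro ext) simp
  then show ?case using insert by (auto intro!: continuous_on_min)
qed simp

text \<open>The new vertex is sent to the barycentre of \<open>\<sigma>\<close>; conversely, a point of the old realization
  gets as new coordinate the common part of its \<open>\<sigma>\<close>-coordinates.\<close>

lemma stellar_homeomorphic:
  assumes K: "fin_complex K" and \<sigma>: "\<sigma> \<noteq> {}" "finite \<sigma>" and a: "a \<notin> \<Union>K" "a \<notin> \<sigma>"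
  shows "geometric_realization K homeomorphic_space geometric_realization (stellar \<sigma> a K)"
proof -
  \<comment> \<open>The barycentre of \<open>\<sigma>\<close> has coordinates \<open>1 / c\<close>;
    this is the origin of the shares \<open>x a / c\<close> in \<open>f\<close> and of the factor
    \<open>c\<close> in \<open>g\<close>.\<close>
  define c where "c = real (card \<sigma>)"
  have c: "c > 0" using \<sigma> by (simp add: c_def card_gt_0_iff)
  define f where "f = (\<lambda>x v. if v = a then 0 else if v \<in> \<sigma> then x v + x a / c else x v :: real)"
  define m where "m = (\<lambda>y. Min ((\<lambda>v. y v) ` \<sigma>) :: real)"
  define g where "g = (\<lambda>y v. if v = a then c * m y else if v \<in> \<sigma> then y v - m y else y v)"
  define U where "U = insert a (\<Union>K \<union> \<sigma>)"
  have U: "finite U" "\<Union>K \<subseteq> U" using fin_complex_finite_vertices[OF K] \<sigma> by (auto simp: U_def)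
  have U': "\<Union>(stellar \<sigma> a K) \<subseteq> U"
    by (auto simp: stellar_def U_def split: if_splits)
  have splitU: "(\<Sum>v\<in>U. h v) = h a + (\<Sum>v\<in>\<sigma>. h v) + (\<Sum>v\<in>U - insert a \<sigma>. h v)" for h :: "'a \<Rightarrow> real"
  proof -
    have "(\<Sum>v\<in>U. h v) = (\<Sum>v\<in>insert a \<sigma>. h v) + (\<Sum>v\<in>U - insert a \<sigma>. h v)"
      using U(1) sum.subset_diff[of "insert a \<sigma>" U h] by (auto simp: U_def add.commute)
    then show ?thesis using a \<sigma> by simp
  qed
  note inK = realization_set_iff[OF U] and inS = realization_set_iff[OF U(1) U']
  have m_le: "m y \<le> y v" if "v \<in> \<sigma>" for y v using that \<sigma> by (simp add: m_def)
  have m_at: "\<exists>v\<in>\<sigma>. m y = y v" for y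
  proof -
    have "m y \<in> (\<lambda>v. y v) ` \<sigma>" unfolding m_def by (rule Min_in) (use \<sigma> in auto)
    then show ?thesis by auto
  qed
  have f_in: "f x \<in> realization_set K" if x: "x \<in> realization_set (stellar \<sigma> a K)" for x
  proof -
    have x0: "\<And>v. 0 \<le> x v" and s: "{v. x v \<noteq> 0} \<in> stellar \<sigma> a K" and s1: "sum x U = 1"
      using x inS by blast+
    have "{v. f x v \<noteq> 0} = (if x a = 0 then {v. x v \<noteq> 0} else ({v. x v \<noteq> 0} - {a}) \<union> \<sigma>)"
    proof (cases "x a = 0")
      case False
      then have "x a / c > 0" using c x0[of a] by simp
      then have "x v + x a / c > 0" for v using x0[of v] by linarith
      then have "x v + x a / c \<noteq> 0" for v by (metis less_irrefl)
      then show ?thesis using False a by (auto simp: f_def)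
    qed (auto simp: f_def)
    then have "{v. f x v \<noteq> 0} \<in> K" using s by (auto simp: stellar_def split: if_splits)
    moreover have "sum (f x) U = 1"
    proof -
      have "(\<Sum>v\<in>\<sigma>. f x v) = (\<Sum>v\<in>\<sigma>. x v + x a / c)" using a by (intro sum.cong) (auto simp: f_def)
      also have "\<dots> = (\<Sum>v\<in>\<sigma>. x v) + x a" using c by (simp add: sum.distrib c_def)
      finally have "(\<Sum>v\<in>\<sigma>. f x v) = (\<Sum>v\<in>\<sigma>. x v) + x a" .
      moreover have "(\<Sum>v\<in>U - insert a \<sigma>. f x v) = (\<Sum>v\<in>U - insert a \<sigma>. x v)"
        by (intro sum.cong) (auto simp: f_def)
      moreover have "f x a = 0" by (simp add: f_def)
      ultimately show ?thesis using splitU[of x] splitU[of "f x"] s1 by linarith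
    qed
    moreover have "0 \<le> f x v" for v using x0 c by (auto simp: f_def)
    ultimately show ?thesis using inK by blast
  qed
  have g_in: "g y \<in> realization_set (stellar \<sigma> a K)" if y: "y \<in> realization_set K" for y
  proof -
    have y0: "\<And>v. 0 \<le> y v" and s: "{v. y v \<noteq> 0} \<in> K" and s1: "sum y U = 1"
      using y inK by blast+
    have ya: "y a = 0" using s a by auto
    obtain v0 where v0: "v0 \<in> \<sigma>" "m y = y v0" using m_at by blast
    have v0a: "v0 \<noteq> a" using v0 a by auto
    have "{v. g y v \<noteq> 0} \<in> stellar \<sigma> a K"
    proof (cases "m y = 0")
      case True
      then have "g y = y" using ya by (auto simp: g_def)
      then show ?thesis using s v0 True ya by (auto simp: stellar_def)
    next
      case False
      then have mp: "m y > 0" using v0 y0[of v0] by simp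
      have "v \<in> \<sigma> \<Longrightarrow> y v \<noteq> 0" for v using mp m_le[of v y] by auto
      then have "({v. g y v \<noteq> 0} - {a}) \<union> \<sigma> = {v. y v \<noteq> 0}"
        using a ya by (auto simp: g_def split: if_splits)
      moreover have "g y a \<noteq> 0" using mp c by (simp add: g_def)
      moreover have "g y v0 = 0" using v0 v0a by (simp add: g_def)
      ultimately show ?thesis using s v0 by (auto simp: stellar_def)
    qed
    moreover have "sum (g y) U = 1"
    proof -
      have "(\<Sum>v\<in>\<sigma>. g y v) = (\<Sum>v\<in>\<sigma>. y v - m y)" using a by (intro sum.cong) (auto simp: g_def)
      also have "\<dots> = (\<Sum>v\<in>\<sigma>. y v) - c * m y" using c by (simp add: sum_subtractf c_def)
      finally have "(\<Sum>v\<in>\<sigma>. g y v) = (\<Sum>v\<in>\<sigma>. y v) - c * m y" .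
      moreover have "(\<Sum>v\<in>U - insert a \<sigma>. g y v) = (\<Sum>v\<in>U - insert a \<sigma>. y v)"
        by (intro sum.cong) (auto simp: g_def)
      moreover have "g y a = c * m y" by (simp add: g_def)
      ultimately show ?thesis using splitU[of y] splitU[of "g y"] s1 ya by linarith
    qed
    moreover have "0 \<le> g y v" for v using y0 c m_le[of v y] v0 by (auto simp: g_def)
    ultimately show ?thesis using inS by blast
  qed
  have fg: "f (g y) = y" if y: "y \<in> realization_set K" for y
  proof -
    have "{v. y v \<noteq> 0} \<in> K" using y inK by blast
    then have "y a = 0" using a by auto
    then show ?thesis using c a by (auto simp: f_def g_def)
  qed
  have gf: "g (f x) = x" if x: "x \<in> realization_set (stellar \<sigma> a K)" for x
  proof -
    have x0: "\<And>v. 0 \<le> x v" and s: "{v. x v \<noteq> 0} \<in> stellar \<sigma> a K" using x inS by blast+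
    then obtain v0 where v0: "v0 \<in> \<sigma>" "x v0 = 0" by (auto simp: stellar_def)
    have fs: "f x v = x v + x a / c" if "v \<in> \<sigma>" for v using that a by (auto simp: f_def)
    \<comment> \<open>Some coordinate of \<open>x\<close> on \<open>\<sigma>\<close> is zero, so
      after adding the same share to all of them the minimum is exactly that share.\<close>
    have "m (f x) = x a / c"
    proof (rule antisym)
      show "m (f x) \<le> x a / c" using m_le[OF v0(1), of "f x"] fs[OF v0(1)] v0 by simp
      obtain v where "v \<in> \<sigma>" "m (f x) = f x v" using m_at by blast
      then show "x a / c \<le> m (f x)" using fs x0 by simp
    qed
    then show ?thesis using c a by (auto simp: f_def g_def)
  qed
  have contf: "continuous_on A f" for A
  proof (rule continuous_on_coordinatewise_then_product)
    fix i
    show "continuous_on A (\<lambda>x. f x i)" unfolding f_def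
      using c by (cases "i = a"; cases "i \<in> \<sigma>")
        (auto intro!: continuous_intros continuous_on_subset[OF continuous_on_product_coordinates])
  qed
  have contm: "continuous_on A m" for A unfolding m_def
    by (rule continuous_on_Min) (use \<sigma> in \<open>auto intro: continuous_on_subset[OF continuous_on_product_coordinates]\<close>)
  have contg: "continuous_on A g" for A
  proof (rule continuous_on_coordinatewise_then_product)
    fix i
    show "continuous_on A (\<lambda>x. g x i)" unfolding g_def
      using contm by (cases "i = a"; cases "i \<in> \<sigma>")
        (auto intro!: continuous_intros continuous_on_subset[OF continuous_on_product_coordinates])
  qed
  have "homeomorphic_maps (geometric_realization K) (geometric_realization (stellar \<sigma> a K)) g f"
    unfolding homeomorphic_maps_def geometric_realization_eq
    using contf contg f_in g_in fg gf by auto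
  then show ?thesis by (rule homeomorphic_maps_imp_homeomorphic_space)
qed

subsection \<open>Cones and suspensions\<close>

text \<open>If \<open>\<sigma>\<close> is disjoint from the vertices of \<open>E\<close>, then \<open>sjoin \<sigma> E\<close> and \<open>bjoin \<sigma> E\<close> are the joins of \<open>E\<close>
  with the full simplex on \<open>\<sigma>\<close> and with the boundary of that simplex. In particular \<open>sjoin {v} E\<close> is a cone
  and \<open>bjoin {a, v} E\<close> a suspension.\<close>

definition sjoin :: "'v set \<Rightarrow> 'v set set \<Rightarrow> 'v set set" where
  "sjoin \<sigma> E = {F. F - \<sigma> \<in> E}"

definition bjoin :: "'v set \<Rightarrow> 'v set set \<Rightarrow> 'v set set" where
  "bjoin \<sigma> E = {F. F - \<sigma> \<in> E \<and> \<not> \<sigma> \<subseteq> F}"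

lemma fin_complex_sjoin:
  assumes "fin_complex E" "finite \<sigma>" shows "fin_complex (sjoin \<sigma> E)"
proof
  show "abstract_simplicial_complex (sjoin \<sigma> E)"
    unfolding abstract_simplicial_complex_def
  proof (intro ballI conjI allI impI)
    fix F assume F: "F \<in> sjoin \<sigma> E"
    then show "finite F" using assms complex_finite[of E "F - \<sigma>"] by (auto simp: sjoin_def)
    fix F' assume "F' \<subseteq> F"
    then have "F' - \<sigma> \<subseteq> F - \<sigma>" by auto
    then show "F' \<in> sjoin \<sigma> E" using F assms complexD[of E "F - \<sigma>" "F' - \<sigma>"] by (auto simp: sjoin_def)
  qed
  have "sjoin \<sigma> E \<subseteq> Pow (\<Union>E \<union> \<sigma>)" by (auto simp: sjoin_def)
  then show "finite (sjoin \<sigma> E)"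
    using fin_complex_finite_vertices[of E] assms by (auto intro: finite_subset)
qed

lemma fin_complex_cone: "fin_complex E \<Longrightarrow> fin_complex (sjoin {v} E)"
  by (rule fin_complex_sjoin) auto

lemma fin_complex_sub:
  "\<lbrakk>fin_complex K; L \<subseteq> K; \<And>F F'. \<lbrakk>F \<in> L; F' \<subseteq> F\<rbrakk> \<Longrightarrow> F' \<in> L\<rbrakk> \<Longrightarrow> fin_complex L"
  unfolding abstract_simplicial_complex_def by (meson finite_subset subsetD)

lemma fin_complex_Un: "\<lbrakk>fin_complex K; fin_complex L\<rbrakk> \<Longrightarrow> fin_complex (K \<union> L)"
  unfolding abstract_simplicial_complex_def by blast

lemma fin_complex_bjoin:
  assumes "fin_complex E" "finite \<sigma>" shows "fin_complex (bjoin \<sigma> E)"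
proof (rule fin_complex_sub[OF fin_complex_sjoin[OF assms]])
  show "bjoin \<sigma> E \<subseteq> sjoin \<sigma> E" by (auto simp: bjoin_def sjoin_def)
  fix F F' assume F: "F \<in> bjoin \<sigma> E" "F' \<subseteq> F"
  then have "F' - \<sigma> \<subseteq> F - \<sigma>" by auto
  then show "F' \<in> bjoin \<sigma> E" using F assms complexD[of E "F - \<sigma>" "F' - \<sigma>"] by (auto simp: bjoin_def)
qed

text \<open>Straight lines to the apex stay inside the cone, because on the way the support outside
  \<open>a\<close> can only shrink.\<close>

lemma contractible_cone:
  assumes E: "fin_complex E" "{} \<in> E" and a: "a \<notin> \<Union>E"
  shows "contractible_space (geometric_realization (sjoin {a} E))"
proof -
  let ?R = "realization_set (sjoin {a} E)"
  define U where "U = insert a (\<Union>E)"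
  have U: "finite U" "\<Union>(sjoin {a} E) \<subseteq> U"
    using fin_complex_finite_vertices[of E] E by (auto simp: U_def sjoin_def)
  note inR = realization_set_iff[OF U]
  define e where "e = (\<lambda>v. if v = a then 1 else 0 :: real)"
  define h where "h = (\<lambda>(t, x) v. (1 - t) * x v + t * e v)"
  have "h (t, x) \<in> ?R" if t: "t \<in> {0..1}" and x: "x \<in> ?R" for t x
  proof -
    have x0: "\<And>v. 0 \<le> x v" and s: "{v. x v \<noteq> 0} - {a} \<in> E" and s1: "sum x U = 1"
      using x inR by (auto simp: sjoin_def)
    have "{v. h (t, x) v \<noteq> 0} - {a} \<subseteq> {v. x v \<noteq> 0} - {a}" by (auto simp: h_def e_def)
    then have "{v. h (t, x) v \<noteq> 0} \<in> sjoin {a} E" using s E complexD by (auto simp: sjoin_def)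
    moreover have "sum e U = 1" using U(1) by (simp add: e_def U_def)
    then have "sum (h (t, x)) U = 1"
      by (simp add: h_def sum.distrib s1 flip: sum_distrib_left)
    moreover have "0 \<le> h (t, x) v" for v using t x0 by (auto simp: h_def e_def)
    ultimately show ?thesis using inR by blast
  qed
  moreover have "continuous_on ({0..1} \<times> ?R) h"
  proof (rule continuous_on_coordinatewise_then_product)
    fix i
    have "continuous_on ({0..1} \<times> ?R) (\<lambda>p. snd p i)"
      by (rule continuous_on_product_then_coordinatewise[OF continuous_on_snd[OF continuous_on_id]])
    then show "continuous_on ({0..1} \<times> ?R) (\<lambda>x. h x i)"
      unfolding h_def case_prod_unfold by (intro continuous_intros)
  qed
  moreover have "h (0, x) = x" "h (1, x) = e" for x by (auto simp: h_def)
  ultimately have "homotopic_with_canon (\<lambda>x. True) ?R ?R id (\<lambda>x. e)"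
    unfolding homotopic_with_def
    by (intro exI[of _ h]) (auto simp: continuous_map_subtopology_eu prod_topology_subtopology_eu)
  then show ?thesis unfolding geometric_realization_eq contractible_space_def by blast
qed

text \<open>The sphere \<open>{{}}\<close> of dimension -1 has an empty realization, which is no
  \<open>nsphere n\<close>. Its suspension, consisting of two points, is therefore matched with
  \<open>1\<close> and \<open>-1\<close> directly.\<close>

lemma suspension_two_points:
  fixes a v :: 'a
  assumes "a \<noteq> v"
  shows "geometric_realization (bjoin {a, v} {{}}) homeomorphic_space nsphere 0"
proof -
  define f where "f = (\<lambda>(x :: 'a \<Rightarrow> real) (i :: nat). if i = 0 then x a - x v else 0)"
  define g where "g = (\<lambda>(y :: nat \<Rightarrow> real) (u :: 'a).
    if u = a then (1 + y 0) / 2 else if u = v then (1 - y 0) / 2 else 0)"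
  let ?S = "{x. (\<Sum>i\<le>0. x i ^ 2) = 1 \<and> (\<forall>i>0. x i = 0)} :: (nat \<Rightarrow> real) set"
  let ?R = "realization_set (bjoin {a, v} {{}})"
  have U: "finite {a, v}" "\<Union>(bjoin {a, v} {{}}) \<subseteq> {a, v}" by (auto simp: bjoin_def)
  have R: "x \<in> ?R \<longleftrightarrow> (\<forall>u. u \<noteq> a \<and> u \<noteq> v \<longrightarrow> x u = 0) \<and> (x a = 1 \<and> x v = 0 \<or> x a = 0 \<and> x v = 1)" for x
  proof
    assume "x \<in> ?R"
    then have x: "{u. x u \<noteq> 0} - {a, v} = {}" "\<not> {a, v} \<subseteq> {u. x u \<noteq> 0}" "x a + x v = 1"
      unfolding realization_set_iff[OF U] using assms by (auto simp: bjoin_def)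
    from x(1) have "\<forall>u. u \<noteq> a \<and> u \<noteq> v \<longrightarrow> x u = 0" by blast
    with x(2,3) show "(\<forall>u. u \<noteq> a \<and> u \<noteq> v \<longrightarrow> x u = 0) \<and> (x a = 1 \<and> x v = 0 \<or> x a = 0 \<and> x v = 1)"
      by auto
  next
    assume x: "(\<forall>u. u \<noteq> a \<and> u \<noteq> v \<longrightarrow> x u = 0) \<and> (x a = 1 \<and> x v = 0 \<or> x a = 0 \<and> x v = 1)"
    then have "0 \<le> x u" for u by (cases "u = a"; cases "u = v") auto
    with x show "x \<in> ?R" unfolding realization_set_iff[OF U] using assms by (auto simp: bjoin_def)
  qed
  have S: "y \<in> ?S \<longleftrightarrow> (\<forall>i>0. y i = 0) \<and> (y 0 = 1 \<or> y 0 = -1)" for y :: "nat \<Rightarrow> real"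
    by (auto simp: power2_eq_1_iff)
  have "f x \<in> ?S \<and> g (f x) = x" if "x \<in> ?R" for x
    using that assms unfolding R S by (auto simp: f_def g_def)
  moreover have "g y \<in> ?R \<and> f (g y) = y" if "y \<in> ?S" for y
    using that assms unfolding R S by (auto simp: f_def g_def)
  moreover have "continuous_on A (\<lambda>x. f x i)" for A i unfolding f_def
    by (cases "i = 0")
      (auto intro!: continuous_intros continuous_on_subset[OF continuous_on_product_coordinates])
  then have "continuous_on A f" for A
    by (intro continuous_on_coordinatewise_then_product) auto
  moreover have "continuous_on A (\<lambda>x. g x i)" for A i unfolding g_def
    by (cases "i = a"; cases "i = v")
      (auto intro!: continuous_intros continuous_on_subset[OF continuous_on_product_coordinates])
  then have "continuous_on A g" for A
    by (intro continuous_on_coordinatewise_then_product) auto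
  ultimately have "homeomorphic_maps (geometric_realization (bjoin {a, v} {{}})) (nsphere 0) f g"
    unfolding homeomorphic_maps_def geometric_realization_eq nsphere_eq by auto
  then show ?thesis by (rule homeomorphic_maps_imp_homeomorphic_space)
qed

text \<open>The height \<open>z\<close> runs from \<open>-1\<close> at the vertex \<open>v\<close>
  to \<open>1\<close> at \<open>a\<close>. The slice at a given height is a copy of \<open>L\<close>
  scaled by \<open>\<tau> = 1 - |z|\<close>, and it is sent to the parallel of radius
  \<open>sqrt (1 - z^2)\<close>. As the source is compact, a continuous bijection suffices.\<close>

lemma suspension_nsphere:
  fixes a v :: 'v
  assumes L: "fin_complex L" and av: "a \<noteq> v" "a \<notin> \<Union>L" "v \<notin> \<Union>L"
    and hom: "geometric_realization L homeomorphic_space nsphere n"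
  shows "geometric_realization (bjoin {a, v} L) homeomorphic_space nsphere (Suc n)"
proof -
  let ?S = "\<lambda>n. {x. (\<Sum>i\<le>n. x i ^ 2) = 1 \<and> (\<forall>i>n. x i = 0)} :: (nat \<Rightarrow> real) set"
  let ?A = "realization_set L" and ?R = "realization_set (bjoin {a, v} L)"
  obtain h k where "homeomorphic_maps (top_of_set ?A) (top_of_set (?S n)) h k"
    using hom unfolding geometric_realization_eq nsphere_eq homeomorphic_space_def by blast
  then have h: "continuous_on ?A h" "\<And>x. x \<in> ?A \<Longrightarrow> h x \<in> ?S n \<and> k (h x) = x"
    and k: "\<And>y. y \<in> ?S n \<Longrightarrow> k y \<in> ?A \<and> h (k y) = y"
    unfolding homeomorphic_maps_def by (auto simp: Pi_iff)
  define U where "U = \<Union>L \<union> {a, v}"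
  have U: "finite U" "\<Union>L \<subseteq> U" "\<Union>(bjoin {a, v} L) \<subseteq> U"
    using fin_complex_finite_vertices[OF L] by (auto simp: U_def bjoin_def)
  note inA = realization_set_iff[OF U(1,2)] and inR = realization_set_iff[OF U(1,3)]
  have sumU: "sum x U = x a + x v + sum x (U - {a, v})" for x :: "'v \<Rightarrow> real"
  proof -
    have "sum x U = sum x {a, v} + sum x (U - {a, v})"
      using U(1) sum.subset_diff[of "{a, v}" U x] by (auto simp: U_def add.commute)
    then show ?thesis using av by simp
  qed
  define z where "z = (\<lambda>x :: 'v \<Rightarrow> real. x a - x v)"
  define \<tau> where "\<tau> = (\<lambda>x :: 'v \<Rightarrow> real. 1 - x a - x v)"
  \<comment> \<open>This is the radial projection to \<open>L\<close>. At the poles, where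
    \<open>\<tau> x = 0\<close>, division by zero makes \<open>p x\<close> the zero function, which
    is no point of the realization; there the square root in \<open>g\<close> vanishes.\<close>
  define p where "p = (\<lambda>(x :: 'v \<Rightarrow> real) u. if u \<in> {a, v} then 0 else x u / \<tau> x)"
  define g where "g = (\<lambda>x i. if i \<le> n then sqrt (1 - (z x)\<^sup>2) * h (p x) i else if i = Suc n then z x else 0)"
  have facts: "0 \<le> x u" "x a = 0 \<or> x v = 0" "{w. x w \<noteq> 0} - {a, v} \<in> L"
      "\<tau> x = sum x (U - {a, v})" "0 \<le> \<tau> x" "\<tau> x = 1 - \<bar>z x\<bar>" "\<bar>z x\<bar> \<le> 1"
    if x: "x \<in> ?R" for x u
  proof -
    have x0: "0 \<le> x u" for u using x inR by blast
    then show "0 \<le> x u" .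
    have B: "{w. x w \<noteq> 0} \<in> bjoin {a, v} L" and s: "sum x U = 1" using x inR by blast+
    from B show 1: "x a = 0 \<or> x v = 0" and "{w. x w \<noteq> 0} - {a, v} \<in> L" by (auto simp: bjoin_def)
    show 2: "\<tau> x = sum x (U - {a, v})" using sumU[of x] s by (simp add: \<tau>_def)
    have "0 \<le> sum x (U - {a, v})" using x0 by (intro sum_nonneg) auto
    then show 3: "0 \<le> \<tau> x" using 2 by simp
    show 4: "\<tau> x = 1 - \<bar>z x\<bar>" using 1 x0[of a] x0[of v] by (auto simp: \<tau>_def z_def)
    show "\<bar>z x\<bar> \<le> 1" using 3 4 by simp
  qed
  have p_in: "p x \<in> ?A" if x: "x \<in> ?R" "\<tau> x \<noteq> 0" for x
  proof -
    have "{w. p x w \<noteq> 0} = {w. x w \<noteq> 0} - {a, v}" using x by (auto simp: p_def)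
    then have "{w. p x w \<noteq> 0} \<in> L" using facts(3)[OF x(1)] by simp
    moreover have "sum (p x) (U - {a, v}) = (\<Sum>u\<in>U - {a, v}. x u / \<tau> x)"
      by (intro sum.cong) (auto simp: p_def)
    then have "sum (p x) U = 1"
      using sumU[of "p x"] x(2) facts(4)[OF x(1)] by (simp add: p_def flip: sum_divide_distrib)
    moreover have "0 \<le> p x w" for w using facts(1,5)[OF x(1)] by (simp add: p_def)
    ultimately show ?thesis using inA by blast
  qed
  have coord: "continuous_on B (\<lambda>x. x u)" for B :: "('v \<Rightarrow> real) set" and u
    by (rule continuous_on_subset[OF continuous_on_product_coordinates]) simp
  have cz: "continuous_on B z" for B unfolding z_def by (intro continuous_intros coord)
  have c\<tau>: "continuous_on B \<tau>" for B unfolding \<tau>_def by (intro continuous_intros coord)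
  have h_bound: "\<bar>h y i\<bar> \<le> 1" if "y \<in> ?A" for y i
  proof (cases "i \<le> n")
    case True
    have "(h y i)\<^sup>2 \<le> (\<Sum>i\<le>n. (h y i)\<^sup>2)" using True by (intro member_le_sum) auto
    also have "\<dots> = 1" using h(2)[OF that] by simp
    finally show ?thesis by (simp add: abs_square_le_1)
  next
    case False
    then show ?thesis using h(2)[OF that] by simp
  qed
  have cont: "continuous_on ?R (\<lambda>x. sqrt (1 - (z x)\<^sup>2) * h (p x) i)" for i
  proof -
    let ?f = "\<lambda>x. sqrt (1 - (z x)\<^sup>2) * h (p x) i"
    let ?O = "{x. \<tau> x \<noteq> 0}"
    have "continuous_on (?R \<inter> ?O) (\<lambda>x. p x u)" for u
      unfolding p_def by (cases "u \<in> {a, v}") (auto intro!: continuous_intros coord c\<tau>)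
    then have "continuous_on (?R \<inter> ?O) p" by (rule continuous_on_coordinatewise_then_product)
    then have "continuous_on (?R \<inter> ?O) (\<lambda>x. h (p x))"
      by (rule continuous_on_compose2[OF h(1)]) (use p_in in auto)
    then have "continuous_on (?R \<inter> ?O) (\<lambda>x. h (p x) i)"
      by (rule continuous_on_product_then_coordinatewise)
    then have c1: "continuous_on (?R \<inter> ?O) ?f" by (intro continuous_intros cz)
    have op: "open ?O"
      using open_Collect_neq[OF c\<tau>[of UNIV] continuous_on_const[of UNIV 0]] by simp
    show ?thesis unfolding continuous_on_def
    proof
      fix x assume x: "x \<in> ?R"
      show "(?f \<longlongrightarrow> ?f x) (at x within ?R)"
      proof (cases "\<tau> x = 0")
        case False
        then have "(?f \<longlongrightarrow> ?f x) (at x within ?R \<inter> ?O)"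
          using c1 x by (simp add: continuous_on_def)
        moreover have "at x within ?R \<inter> ?O = at x within ?R"
          by (rule at_within_nhd[of x ?O]) (use op False in auto)
        ultimately show ?thesis by simp
      next
        \<comment> \<open>Near a pole \<open>h (p y)\<close> need not converge, but its coordinates
          are bounded by one while the square root tends to zero.\<close>
        case True
        then have "\<bar>z x\<bar> = 1" using facts(6)[OF x] by simp
        then have "(z x)\<^sup>2 = 1" by (simp add: abs_square_eq_1)
        then have fx: "?f x = 0" and sx: "sqrt (1 - (z x)\<^sup>2) = 0" by auto
        have "continuous_on ?R (\<lambda>x. sqrt (1 - (z x)\<^sup>2))" by (intro continuous_intros cz)
        then have "((\<lambda>y. sqrt (1 - (z y)\<^sup>2)) \<longlongrightarrow> 0) (at x within ?R)"
          unfolding continuous_on_def using x sx by force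
        moreover have "norm (?f y) \<le> sqrt (1 - (z y)\<^sup>2)" if y: "y \<in> ?R" for y
        proof (cases "\<tau> y = 0")
          case True
          then have "\<bar>z y\<bar> = 1" using facts(6)[OF y] by simp
          then have "(z y)\<^sup>2 = 1" by (simp add: abs_square_eq_1)
          then show ?thesis by simp
        next
          case False
          have "0 \<le> 1 - (z y)\<^sup>2" using facts(7)[OF y] by (simp add: abs_square_le_1)
          then show ?thesis using h_bound[OF p_in[OF y False], of i]
            by (simp add: abs_mult mult_left_le)
        qed
        then have "\<forall>\<^sub>F y in at x within ?R. norm (?f y) \<le> sqrt (1 - (z y)\<^sup>2)"
          by (simp add: eventually_at_filter)
        ultimately have "(?f \<longlongrightarrow> 0) (at x within ?R)" by (rule Lim_null_comparison[rotated])
        then show ?thesis unfolding fx .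
      qed
    qed
  qed
  have "continuous_on ?R (\<lambda>x. g x i)" for i unfolding g_def
    using cont[of i] cz by (cases "i \<le> n"; cases "i = Suc n") auto
  then have cg: "continuous_on ?R g" by (rule continuous_on_coordinatewise_then_product)
  have sq: "0 < 1 - (z x)\<^sup>2" if "x \<in> ?R" "\<tau> x \<noteq> 0" for x
  proof -
    have "\<bar>z x\<bar> < 1" using facts(5,6)[OF that(1)] that(2) by linarith
    then show ?thesis by (simp add: abs_square_less_1)
  qed
  have g_in: "g x \<in> ?S (Suc n)" if x: "x \<in> ?R" for x
  proof -
    have "(\<Sum>i\<le>n. (g x i)\<^sup>2) = (1 - (z x)\<^sup>2)"
    proof (cases "\<tau> x = 0")
      case True
      then have "\<bar>z x\<bar> = 1" using facts(6)[OF x] by simp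
      then have "(z x)\<^sup>2 = 1" by (simp add: abs_square_eq_1)
      then show ?thesis by (simp add: g_def)
    next
      case False
      have "(\<Sum>i\<le>n. (g x i)\<^sup>2) = (\<Sum>i\<le>n. (1 - (z x)\<^sup>2) * (h (p x) i)\<^sup>2)"
        using sq[OF x False] by (intro sum.cong) (auto simp: g_def power_mult_distrib)
      also have "\<dots> = 1 - (z x)\<^sup>2" using h(2)[OF p_in[OF x False]] by (simp flip: sum_distrib_left)
      finally show ?thesis .
    qed
    then show ?thesis by (auto simp: g_def)
  qed
  have inj: "inj_on g ?R"
  proof (rule inj_onI)
    fix x y assume x: "x \<in> ?R" and y: "y \<in> ?R" and e: "g x = g y"
    have zz: "z x = z y" using fun_cong[OF e, of "Suc n"] by (simp add: g_def)
    then have \<tau>\<tau>: "\<tau> x = \<tau> y" using facts(6)[OF x] facts(6)[OF y] by simp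
    have av': "x a = y a" "x v = y v"
      using zz facts(2)[OF x] facts(2)[OF y] facts(1)[OF x, of a] facts(1)[OF x, of v]
        facts(1)[OF y, of a] facts(1)[OF y, of v] by (auto simp: z_def)
    have "x u = y u" if u: "u \<notin> {a, v}" for u
    proof (cases "\<tau> x = 0")
      case True
      have zero: "w u = 0" if w: "w \<in> ?R" "\<tau> w = 0" for w
      proof (cases "u \<in> U")
        case True
        have "sum w (U - {a, v}) = 0" using facts(4)[OF w(1)] w(2) by simp
        then show ?thesis using U(1) facts(1)[OF w(1)] True u by (subst (asm) sum_nonneg_eq_0_iff) auto
      next
        case False
        then show ?thesis using facts(3)[OF w(1)] u by (auto simp: U_def)
      qed
      show ?thesis using zero[OF x True] zero[OF y] True \<tau>\<tau> by simp
    next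
      case False
      then have Fy: "\<tau> y \<noteq> 0" using \<tau>\<tau> by simp
      have "h (p x) i = h (p y) i" for i
      proof (cases "i \<le> n")
        case True
        then show ?thesis using fun_cong[OF e, of i] sq[OF x False] zz by (simp add: g_def)
      next
        case i: False
        then show ?thesis using h(2)[OF p_in[OF x False]] h(2)[OF p_in[OF y Fy]] by simp
      qed
      then have "h (p x) = h (p y)" by blast
      then have "p x = p y" using h(2)[OF p_in[OF x False]] h(2)[OF p_in[OF y Fy]] by metis
      from fun_cong[OF this, of u] show ?thesis using u False \<tau>\<tau> by (simp add: p_def)
    qed
    then have "x u = y u" for u using av' by (cases "u \<in> {a, v}") auto
    then show "x = y" by blast
  qed
  have surj: "\<exists>x\<in>?R. g x = y" if y: "y \<in> ?S (Suc n)" for y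
  proof -
    define w where "w = y (Suc n)"
    have y1: "(\<Sum>i\<le>n. (y i)\<^sup>2) = 1 - w\<^sup>2" and y2: "\<And>i. i > Suc n \<Longrightarrow> y i = 0"
      using y by (auto simp: w_def)
    have "0 \<le> (\<Sum>i\<le>n. (y i)\<^sup>2)" by (intro sum_nonneg) auto
    then have w1: "\<bar>w\<bar> \<le> 1" using y1 by (simp add: abs_square_le_1)
    obtain q where q: "q \<in> ?A" "\<And>i. i \<le> n \<Longrightarrow> y i = sqrt (1 - w\<^sup>2) * h q i"
    proof (cases "w\<^sup>2 = 1")
      case True
      then have "y i = 0" if "i \<le> n" for i
        using y1 that by (auto simp: sum_nonneg_eq_0_iff)
      moreover obtain q where "q \<in> ?A"
      proof -
        have "(\<lambda>i. if i = 0 then 1 else 0) \<in> ?S n"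
          using in_topspace_nsphere[of n] by (simp add: nsphere_eq)
        from k[OF this] show ?thesis using that by blast
      qed
      ultimately show ?thesis using that[of q] True by simp
    next
      case False
      then have wp: "0 < 1 - w\<^sup>2" using w1 by (metis abs_square_le_1 diff_gt_0_iff_gt order_le_less)
      define y' where "y' = (\<lambda>i. if i \<le> n then y i / sqrt (1 - w\<^sup>2) else 0)"
      have "(\<Sum>i\<le>n. (y' i)\<^sup>2) = (\<Sum>i\<le>n. (y i)\<^sup>2 / (1 - w\<^sup>2))"
        using wp by (intro sum.cong) (auto simp: y'_def power_divide)
      also have "\<dots> = 1" using wp y1 by (simp flip: sum_divide_distrib)
      finally have "y' \<in> ?S n" by (simp add: y'_def)
      then show ?thesis using k[of y'] that[of "k y'"] wp by (simp add: y'_def)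
    qed
    \<comment> \<open>The positive and negative parts of the height become the coordinates of the
      two poles, and the remaining mass is placed at the point \<open>q\<close> of
      \<open>L\<close>.\<close>
    define x where "x = (\<lambda>u. if u = a then max w 0 else if u = v then max (-w) 0 else (1 - \<bar>w\<bar>) * q u)"
    have xa: "x a = max w 0" "x v = max (-w) 0" using av by (auto simp: x_def)
    have q0: "\<And>u. 0 \<le> q u" "{u. q u \<noteq> 0} \<in> L" "sum q U = 1" using q(1) inA by blast+
    then have qa: "q a = 0" "q v = 0" using av by auto
    have "{u. x u \<noteq> 0} \<in> bjoin {a, v} L"
    proof -
      have "{u. x u \<noteq> 0} - {a, v} \<subseteq> {u. q u \<noteq> 0}" by (auto simp: x_def)
      then have "{u. x u \<noteq> 0} - {a, v} \<in> L" using complexD[of L] L q0(2) by blast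
      moreover have "x a = 0 \<or> x v = 0" using xa by auto
      ultimately show ?thesis by (auto simp: bjoin_def)
    qed
    moreover have "sum x U = 1"
    proof -
      have "sum x (U - {a, v}) = (\<Sum>u\<in>U - {a, v}. (1 - \<bar>w\<bar>) * q u)"
        by (intro sum.cong) (auto simp: x_def)
      also have "\<dots> = 1 - \<bar>w\<bar>" using sumU[of q] q0(3) qa by (simp flip: sum_distrib_left)
      finally show ?thesis using sumU[of x] xa by (auto simp: max_def)
    qed
    moreover have "0 \<le> x u" for u using q0(1) w1 by (auto simp: x_def)
    ultimately have xR: "x \<in> ?R" using inR by blast
    have zx: "z x = w" using xa by (auto simp: z_def)
    have "g x = y"
    proof
      fix i
      consider "i \<le> n" | "i = Suc n" | "i > Suc n" by linarith
      then show "g x i = y i"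
      proof cases
        case 1
        show ?thesis
        proof (cases "\<bar>w\<bar> = 1")
          case True
          then have "w\<^sup>2 = 1" by (simp add: abs_square_eq_1)
          then show ?thesis using 1 q(2)[OF 1] zx by (simp add: g_def)
        next
          case False
          have "\<tau> x = 1 - \<bar>w\<bar>" using facts(6)[OF xR] zx by simp
          then have "p x = q" using False qa by (auto simp: p_def x_def)
          then show ?thesis using 1 q(2)[OF 1] zx by (simp add: g_def)
        qed
      qed (use zx y2 in \<open>auto simp: g_def w_def\<close>)
    qed
    then show ?thesis using xR by blast
  qed
  have im: "g ` ?R = ?S (Suc n)"
  proof (rule equalityI)
    show "g ` ?R \<subseteq> ?S (Suc n)" using g_in by (rule image_subsetI)
    show "?S (Suc n) \<subseteq> g ` ?R"
    proof
      fix y assume "y \<in> ?S (Suc n)"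
      from surj[OF this] show "y \<in> g ` ?R" by blast
    qed
  qed
  have "fin_complex (bjoin {a, v} L)" using fin_complex_bjoin[OF L] by simp
  from homeomorphic_compact[OF compact_realization_set[OF this] cg im inj]
  have "?R homeomorphic ?S (Suc n)" .
  then show ?thesis unfolding geometric_realization_eq nsphere_eq
    by (rule homeomorphic_space_top_of_set)
qed

lemma simplicial_sphere_suspension:
  assumes "simplicial_sphere L" "a \<noteq> v" "a \<notin> \<Union>L" "v \<notin> \<Union>L"
  shows "\<exists>n. geometric_realization (bjoin {a, v} L) homeomorphic_space nsphere n"
proof (cases "L = {{}}")
  case True
  then show ?thesis using suspension_two_points[OF assms(2)] by metis
next
  case False
  then obtain n where "geometric_realization L homeomorphic_space nsphere n" "fin_complex L"
    using assms(1) unfolding simplicial_sphere_def by auto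
  with suspension_nsphere[of L a v n] assms(2-4) show ?thesis by metis
qed

section \<open>Shellable balls\<close>

text \<open>\<open>pball D B\<close>: the complex \<open>D\<close> is a ball with boundary \<open>B\<close>, built by attaching cones over balls
  contained in the boundary.\<close>

inductive pball :: "'v set set \<Rightarrow> 'v set set \<Rightarrow> bool" where
  simplex: "\<lbrakk>fin_complex E; E \<noteq> {}; finite \<sigma>; \<sigma> \<noteq> {}; \<Union>E \<inter> \<sigma> = {}\<rbrakk>
    \<Longrightarrow> pball (sjoin \<sigma> E) (bjoin \<sigma> E)"
| glue: "\<lbrakk>pball D (L \<union> N); pball L M; fin_complex N; L \<inter> N = M; v \<notin> \<Union>D\<rbrakk>
    \<Longrightarrow> pball (D \<union> sjoin {v} L) (N \<union> sjoin {v} M)"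

lemma subset_sjoin:
  assumes "fin_complex E" shows "E \<subseteq> sjoin \<sigma> E"
proof
  fix F assume "F \<in> E"
  then show "F \<in> sjoin \<sigma> E" using complexD[of E F "F - \<sigma>"] assms by (auto simp: sjoin_def)
qed

lemma pball_complex:
  "pball D B \<Longrightarrow> fin_complex D \<and> fin_complex B \<and> B \<subseteq> D \<and> {} \<in> B"
proof (induction rule: pball.induct)
  case (simplex E \<sigma>)
  have "{} \<in> E" using complex_empty_in[of E] simplex.hyps by blast
  then have "{} \<in> bjoin \<sigma> E" using simplex by (simp add: bjoin_def)
  moreover have "bjoin \<sigma> E \<subseteq> sjoin \<sigma> E" by (auto simp: sjoin_def bjoin_def)
  ultimately show ?case
    using fin_complex_sjoin[OF simplex(1,3)] fin_complex_bjoin[OF simplex(1,3)] by blast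
next
  case (glue D L N M v)
  have LM: "fin_complex D" "fin_complex L" "fin_complex M" "{} \<in> M" "L \<union> N \<subseteq> D"
    using glue.IH by blast+
  have "fin_complex (D \<union> sjoin {v} L)" "fin_complex (N \<union> sjoin {v} M)"
    using fin_complex_Un[OF LM(1) fin_complex_cone[OF LM(2)]]
      fin_complex_Un[OF glue.hyps(3) fin_complex_cone[OF LM(3)]] by blast+
  moreover have "{} \<in> N" "N \<subseteq> D" "M \<subseteq> L" using LM glue.hyps(4) by auto
  moreover have "sjoin {v} M \<subseteq> sjoin {v} L" using \<open>M \<subseteq> L\<close> by (auto simp: sjoin_def)
  ultimately show ?case by blast
qed

text \<open>Coning with \<open>u\<close> enlarges the simplex \<open>\<sigma>\<close> by
  \<open>u\<close> in the base case. It commutes with gluing, since cones from \<open>u\<close> and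
  \<open>v\<close> can be taken in either order and \<open>sjoin {u} L\<close> again lies in the
  boundary of \<open>sjoin {u} D\<close>.\<close>

lemma pball_cone:
  "pball D B \<Longrightarrow> u \<notin> \<Union>D \<Longrightarrow> pball (sjoin {u} D) (D \<union> sjoin {u} B)"
proof (induction rule: pball.induct)
  case (simplex E \<sigma>)
  have "{} \<in> E" using complex_empty_in[of E] simplex.hyps by blast
  then have "\<sigma> \<in> sjoin \<sigma> E" by (simp add: sjoin_def)
  then have u: "u \<notin> \<sigma>" "u \<notin> \<Union>E"
    using simplex.prems subset_sjoin[OF simplex.hyps(1), of \<sigma>] by blast+
  have "sjoin {u} (sjoin \<sigma> E) = sjoin (insert u \<sigma>) E"
  proof -
    have "F - {u} - \<sigma> = F - insert u \<sigma>" for F by auto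
    then show ?thesis unfolding sjoin_def by simp
  qed
  moreover have "sjoin \<sigma> E \<union> sjoin {u} (bjoin \<sigma> E) = bjoin (insert u \<sigma>) E" (is "?l = ?r")
  proof (rule Set.set_eqI)
    fix F
    have 1: "F - {u} - \<sigma> = F - insert u \<sigma>" by auto
    have 2: "\<sigma> \<subseteq> F - {u} \<longleftrightarrow> \<sigma> \<subseteq> F" using u by auto
    have "F \<in> ?l \<longleftrightarrow> F - \<sigma> \<in> E \<or> (F - insert u \<sigma> \<in> E \<and> \<not> \<sigma> \<subseteq> F)"
      unfolding sjoin_def bjoin_def Un_iff mem_Collect_eq 1 2 ..
    also have "\<dots> \<longleftrightarrow> F - insert u \<sigma> \<in> E \<and> \<not> insert u \<sigma> \<subseteq> F"
    proof (cases "u \<in> F")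
      case True
      then have "F - \<sigma> \<notin> E" using u by blast
      then show ?thesis using True by blast
    next
      case False
      then have "F - \<sigma> = F - insert u \<sigma>" by blast
      then show ?thesis using False by auto
    qed
    finally show "F \<in> ?l \<longleftrightarrow> F \<in> ?r" unfolding bjoin_def by simp
  qed
  moreover have "pball (sjoin (insert u \<sigma>) E) (bjoin (insert u \<sigma>) E)"
    using simplex u by (intro pball.simplex) auto
  ultimately show ?case by simp
next
  case (glue D L N M v)
  have D: "fin_complex D" "L \<subseteq> D" "N \<subseteq> D" "fin_complex L" "{} \<in> L" "{} \<in> M"
    using pball_complex[OF glue.hyps(1)] pball_complex[OF glue.hyps(2)] by auto
  then have "{v} \<in> sjoin {v} L" by (simp add: sjoin_def)
  then have u: "u \<notin> \<Union>D" "u \<noteq> v" using glue.prems by auto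
  have uL: "u \<notin> \<Union>L" using u D by auto
  have 1: "pball (sjoin {u} D) (sjoin {u} L \<union> (D \<union> sjoin {u} N))"
  proof -
    have "D \<union> sjoin {u} (L \<union> N) = sjoin {u} L \<union> (D \<union> sjoin {u} N)" by (auto simp: sjoin_def)
    then show ?thesis using glue.IH(1)[OF u(1)] by simp
  qed
  have 2: "pball (sjoin {u} L) (L \<union> sjoin {u} M)" using glue.IH(2) uL by blast
  have 3: "fin_complex (D \<union> sjoin {u} N)"
    using fin_complex_Un[OF D(1) fin_complex_cone[OF glue.hyps(3)]] .
  have 4: "sjoin {u} L \<inter> (D \<union> sjoin {u} N) = L \<union> sjoin {u} M"
  proof (rule Set.set_eqI)
    fix F
    have "u \<notin> F" if "F \<in> D" using that u by auto
    then have "F - {u} = F" if "F \<in> D" using that by auto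
    then show "F \<in> sjoin {u} L \<inter> (D \<union> sjoin {u} N) \<longleftrightarrow> F \<in> L \<union> sjoin {u} M"
      using D(2) glue.hyps(4) unfolding sjoin_def by auto
  qed
  have 5: "v \<notin> \<Union>(sjoin {u} D)" using glue.hyps(5) u by (auto simp: sjoin_def)
  have comm: "F - {v} - {u} = F - {u} - {v}" for F by auto
  have e1: "sjoin {u} D \<union> sjoin {v} (sjoin {u} L) = sjoin {u} (D \<union> sjoin {v} L)"
    unfolding sjoin_def by (auto simp: comm)
  have e2: "D \<union> sjoin {u} N \<union> sjoin {v} (L \<union> sjoin {u} M) = D \<union> sjoin {v} L \<union> sjoin {u} (N \<union> sjoin {v} M)"
    unfolding sjoin_def by (auto simp: comm)
  from pball.glue[OF 1 2 3 4 5] show ?case unfolding e1 e2 .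
qed

section \<open>Joins and the replacement of balls by cones\<close>

text \<open>The join of \<open>J\<close> and \<open>D\<close>, for \<open>J\<close> with vertices inside and \<open>D\<close> with vertices outside \<open>V\<close>.\<close>

definition vjoin :: "'v set \<Rightarrow> 'v set set \<Rightarrow> 'v set set \<Rightarrow> 'v set set" where
  "vjoin V J D = {F. F \<inter> V \<in> J \<and> F - V \<in> D}"

lemma fin_complex_vjoin:
  assumes "fin_complex J" "fin_complex D" shows "fin_complex (vjoin V J D)"
proof
  show "abstract_simplicial_complex (vjoin V J D)"
    unfolding abstract_simplicial_complex_def
  proof (intro ballI conjI allI impI)
    fix F assume F: "F \<in> vjoin V J D"
    then have "finite (F \<inter> V)" "finite (F - V)"
      using assms complex_finite[of J] complex_finite[of D] by (auto simp: vjoin_def)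
    then have "finite (F \<inter> V \<union> (F - V))" by blast
    then show "finite F" by (simp add: Int_Diff_Un)
    fix F' assume "F' \<subseteq> F"
    then have "F' \<inter> V \<subseteq> F \<inter> V" "F' - V \<subseteq> F - V" by auto
    then show "F' \<in> vjoin V J D"
      using F assms complexD[of J "F \<inter> V"] complexD[of D "F - V"] by (auto simp: vjoin_def)
  qed
  have "vjoin V J D \<subseteq> Pow (\<Union>J \<union> \<Union>D)" by (auto simp: vjoin_def)
  then show "finite (vjoin V J D)"
    using fin_complex_finite_vertices[of J] fin_complex_finite_vertices[of D] assms
    by (meson finite_Pow_iff finite_UnI finite_subset)
qed

text \<open>When \<open>J\<close> is not void, \<open>\<sigma>\<close> is no face of
  \<open>X\<close>, because \<open>X\<close> meets the joined piece only over
  \<open>bjoin \<sigma> E\<close>. So the stellar subdivision of the union at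
  \<open>\<sigma>\<close> changes only that piece. The lemma is used in both directions, to
  introduce a cone and to remove a subdividing vertex.\<close>

lemma stellar_vjoin:
  assumes J: "fin_complex J" and V: "V \<inter> \<sigma> = {}" "V \<inter> \<Union>E = {}"
    and E: "fin_complex E" "E \<noteq> {}" "\<Union>E \<inter> \<sigma> = {}" and \<sigma>: "finite \<sigma>" "\<sigma> \<noteq> {}"
    and X: "fin_complex X" "X \<inter> vjoin V J (sjoin \<sigma> E) \<subseteq> vjoin V J (bjoin \<sigma> E)"
    and a: "a \<notin> V" "a \<notin> \<Union>E" "a \<notin> \<sigma>" "a \<notin> \<Union>X" "\<Union>J \<subseteq> V"
  shows "geometric_realization (vjoin V J (sjoin \<sigma> E) \<union> X) homeomorphic_space
    geometric_realization (vjoin V J (sjoin {a} (bjoin \<sigma> E)) \<union> X)"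
proof (cases "J = {}")
  case True
  then show ?thesis by (simp add: vjoin_def)
next
  case False
  let ?K = "vjoin V J (sjoin \<sigma> E) \<union> X"
  have e: "{} \<in> J" "{} \<in> E" using False J E complex_empty_in by blast+
  have K: "fin_complex ?K"
    using fin_complex_Un[OF fin_complex_vjoin[OF J fin_complex_sjoin[OF E(1) \<sigma>(1)]] X(1)] .
  have \<sigma>X: "\<not> \<sigma> \<subseteq> F" if "F \<in> X" for F
  proof
    assume "\<sigma> \<subseteq> F"
    then have "\<sigma> \<in> X" using that X complexD by blast
    moreover have "\<sigma> \<inter> V = {}" "\<sigma> - V = \<sigma>" using V by auto
    ultimately have "\<sigma> \<in> vjoin V J (bjoin \<sigma> E)" using X(2) e by (auto simp: vjoin_def sjoin_def)
    then show False using \<open>\<sigma> - V = \<sigma>\<close> by (auto simp: vjoin_def bjoin_def)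
  qed
  have aK: "a \<notin> \<Union>?K" using a by (auto simp: vjoin_def sjoin_def)
  have "stellar \<sigma> a ?K = vjoin V J (sjoin {a} (bjoin \<sigma> E)) \<union> X"
  proof (rule Set.set_eqI)
    fix F
    have s: "\<sigma> \<subseteq> F - V - {a} \<longleftrightarrow> \<sigma> \<subseteq> F" using V a by auto
    show "F \<in> stellar \<sigma> a ?K \<longleftrightarrow> F \<in> vjoin V J (sjoin {a} (bjoin \<sigma> E)) \<union> X"
    proof (cases "a \<in> F")
      case True
      have "(F - {a} \<union> \<sigma>) \<inter> V = F \<inter> V" "(F - {a} \<union> \<sigma>) - V - \<sigma> = F - V - {a} - \<sigma>"
        using V a by auto
      moreover have "F - {a} \<union> \<sigma> \<notin> X" using \<sigma>X by blast
      moreover have "F \<notin> X" using True a by auto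
      ultimately show ?thesis using True s by (auto simp: stellar_def vjoin_def sjoin_def bjoin_def)
    next
      case False
      then have "F - V - {a} = F - V" by auto
      then show ?thesis using False s \<sigma>X by (auto simp: stellar_def vjoin_def sjoin_def bjoin_def)
    qed
  qed
  then show ?thesis using stellar_homeomorphic[OF K \<sigma>(2,1) aK a(3)] by simp
qed

text \<open>In every context that meets a ball only in its boundary, the ball can be replaced by the cone
  over its boundary. For the induction the context also contains a join factor \<open>J\<close>: after \<open>D\<close> is
  replaced by the cone with apex \<open>a\<close>, the ball \<open>L\<close> occurs joined with the two points \<open>a\<close> and \<open>v\<close>;
  replacing it by a cone with apex \<open>w\<close> leaves a subdivision of the edge \<open>av\<close> at \<open>w\<close>.\<close>

lemma pball_replace_by_cone:
  fixes D :: "nat set set"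
  shows "\<lbrakk>pball D B; finite V; fin_complex J; \<Union>J \<subseteq> V; V \<inter> \<Union>D = {}; fin_complex X;
    a \<notin> V; a \<notin> \<Union>D; a \<notin> \<Union>X; X \<inter> vjoin V J D \<subseteq> vjoin V J B\<rbrakk>
  \<Longrightarrow> geometric_realization (vjoin V J D \<union> X) homeomorphic_space
      geometric_realization (vjoin V J (sjoin {a} B) \<union> X)"
proof (induction arbitrary: V J X a rule: pball.induct)
  case (simplex E \<sigma>)
  have "{} \<in> E" using complex_empty_in[of E] simplex.hyps by blast
  then have "\<sigma> \<subseteq> \<Union>(sjoin \<sigma> E)" by (intro Union_upper) (simp add: sjoin_def)
  moreover have "\<Union>E \<subseteq> \<Union>(sjoin \<sigma> E)" by (intro Union_mono subset_sjoin[OF simplex.hyps(1)])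
  ultimately have "V \<inter> \<sigma> = {}" "V \<inter> \<Union>E = {}" "a \<notin> \<Union>E" "a \<notin> \<sigma>"
    using simplex.prems(4,7) by auto
  then show ?case using simplex.hyps simplex.prems
    by (intro stellar_vjoin)
next
  case (glue D L N M v)
  note V = \<open>finite V\<close> and J = \<open>fin_complex J\<close> \<open>\<Union>J \<subseteq> V\<close> and X = \<open>fin_complex X\<close>
  have DL: "fin_complex D" "L \<subseteq> D" "N \<subseteq> D" "M \<subseteq> L" "M \<subseteq> N" "fin_complex L" "fin_complex M" "{} \<in> L" "{} \<in> M"
    using pball_complex[OF glue.hyps(1)] pball_complex[OF glue.hyps(2)] glue.hyps(4) by auto
  note N = \<open>fin_complex N\<close>
  have "{v} \<in> sjoin {v} L" using DL by (simp add: sjoin_def)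
  then have vV: "v \<notin> V" "V \<inter> \<Union>D = {}" "v \<noteq> a" "a \<notin> \<Union>D"
    using glue.prems by blast+
  have aV: "a \<notin> V" and aX: "a \<notin> \<Union>X" and vD: "v \<notin> \<Union>D"
    using glue.prems glue.hyps by blast+
  have XB: "F \<in> vjoin V J (N \<union> sjoin {v} M)" if "F \<in> X" "F \<in> vjoin V J (D \<union> sjoin {v} L)" for F
    using glue.prems(9) that by blast
  have vF: "v \<notin> F" if "F - V - {a} \<in> D" for F using that vD vV(1,3) by blast
  have vF': "v \<notin> F" if "F - V \<in> D" for F using that vD vV(1) by blast
  \<comment> \<open>\<open>X1\<close> is the surrounding of \<open>D\<close>. Once \<open>D\<close>
    has become a cone with apex \<open>a\<close>, the cone over \<open>N\<close> joins the
    surrounding, giving \<open>X2\<close>, and \<open>L\<close> is left with the two apices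
    \<open>a\<close> and \<open>v\<close>, which are recorded in the join factor
    \<open>J'\<close>.\<close>
  define X1 where "X1 = vjoin V J (sjoin {v} L) \<union> X"
  define X2 where "X2 = vjoin V J (sjoin {a} N) \<union> X"
  define V' where "V' = V \<union> {a, v}"
  define J' where "J' = bjoin {a, v} J"
  have fc: "fin_complex X1" "fin_complex X2" "fin_complex J'"
    unfolding X1_def X2_def J'_def
    using fin_complex_Un[OF fin_complex_vjoin[OF J(1) fin_complex_cone[OF DL(6)]] X]
      fin_complex_Un[OF fin_complex_vjoin[OF J(1) fin_complex_cone[OF N]] X] fin_complex_bjoin[OF J(1)] by simp_all
  obtain w where w: "w \<notin> V' \<union> \<Union>D \<union> \<Union>X2"
  proof -
    have "finite (V' \<union> \<Union>D \<union> \<Union>X2)"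
      using V fin_complex_finite_vertices[OF DL(1)] fin_complex_finite_vertices[OF fc(2)]
      by (simp add: V'_def)
    from ex_new_if_finite[OF infinite_UNIV_nat this] show ?thesis using that by auto
  qed
  have w': "w \<notin> V" "w \<noteq> a" "w \<noteq> v" "w \<notin> \<Union>D" "w \<notin> \<Union>X2" using w by (auto simp: V'_def)
  have V'F: "F \<inter> V' - {a, v} = F \<inter> V" "{a, v} \<subseteq> F \<inter> V' \<longleftrightarrow> {a, v} \<subseteq> F" for F
    using aV vV(1) unfolding V'_def by blast+
  have V'v: "v \<notin> F \<Longrightarrow> F - V' = F - V - {a}" and V'a: "a \<notin> F \<Longrightarrow> F - V' = F - V - {v}" for F
    unfolding V'_def by blast+
  have jm: "F \<in> vjoin V' J' E \<longleftrightarrow> F \<inter> V \<in> J \<and> \<not> {a, v} \<subseteq> F \<and> F - V' \<in> E" for F E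
    unfolding vjoin_def J'_def bjoin_def mem_Collect_eq V'F by blast
  have "vjoin V J (D \<union> sjoin {v} L) \<union> X = vjoin V J D \<union> X1" by (auto simp: vjoin_def X1_def)
  also have "geometric_realization (vjoin V J D \<union> X1) homeomorphic_space
      geometric_realization (vjoin V J (sjoin {a} (L \<union> N)) \<union> X1)"
  proof (rule glue.IH(1)[OF V J vV(2) fc(1) aV vV(4)])
    have "a \<notin> F" if "F - V - {v} \<in> L" for F using that vV(3,4) aV DL(2) by blast
    then show "a \<notin> \<Union>X1" using aX by (auto simp: X1_def vjoin_def sjoin_def)
    show "X1 \<inter> vjoin V J D \<subseteq> vjoin V J (L \<union> N)"
    proof
      fix F assume F: "F \<in> X1 \<inter> vjoin V J D"
      then have FD: "F - V \<in> D" "F \<inter> V \<in> J" by (auto simp: vjoin_def)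
      have nv: "F - V - {v} = F - V" using vF'[OF FD(1)] by auto
      show "F \<in> vjoin V J (L \<union> N)"
      proof (cases "F \<in> X")
        case True
        then have "F \<in> vjoin V J (N \<union> sjoin {v} M)" using XB FD by (auto simp: vjoin_def)
        then show ?thesis using nv DL by (auto simp: vjoin_def sjoin_def)
      next
        case False
        then show ?thesis using F nv by (auto simp: X1_def vjoin_def sjoin_def)
      qed
    qed
  qed
  also have "vjoin V J (sjoin {a} (L \<union> N)) \<union> X1 = vjoin V' J' L \<union> X2"
  proof (rule Set.set_eqI)
    fix F
    have "F - V' \<in> L \<and> \<not> {a, v} \<subseteq> F \<longleftrightarrow> F - V - {a} \<in> L \<or> F - V - {v} \<in> L"
    proof -
      have "v \<notin> F" if "F - V - {a} \<in> L" using that vF DL(2) by blast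
      moreover have "a \<notin> F" if "F - V - {v} \<in> L" using that vV(3,4) aV DL(2) by blast
      ultimately show ?thesis using V'v[of F] V'a[of F] by (metis insert_subset empty_subsetI)
    qed
    then have "F \<in> vjoin V' J' L \<longleftrightarrow> F \<inter> V \<in> J \<and> (F - V - {a} \<in> L \<or> F - V - {v} \<in> L)"
      unfolding jm by blast
    then show "F \<in> vjoin V J (sjoin {a} (L \<union> N)) \<union> X1 \<longleftrightarrow> F \<in> vjoin V' J' L \<union> X2"
      unfolding X1_def X2_def Un_iff by (auto simp: vjoin_def sjoin_def)
  qed
  also have "geometric_realization (vjoin V' J' L \<union> X2) homeomorphic_space
      geometric_realization (vjoin V' J' (sjoin {w} M) \<union> X2)"
  proof (rule glue.IH(2))
    show "finite V'" using V by (simp add: V'_def)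
    show "fin_complex J'" by (fact fc)
    show "\<Union>J' \<subseteq> V'"
    proof (rule Union_least)
      fix F assume "F \<in> J'"
      then have "F - {a, v} \<subseteq> V" using J(2) unfolding J'_def bjoin_def by blast
      then show "F \<subseteq> V'" unfolding V'_def by blast
    qed
    have "V' \<inter> A = {}" if "A \<subseteq> C" "V \<inter> C = {}" "a \<notin> C" "v \<notin> C" for A C
      unfolding V'_def using that by blast
    from this[OF Union_mono[OF DL(2)] vV(2,4) vD] show "V' \<inter> \<Union>L = {}" .
    show "fin_complex X2" by (fact fc)
    show "w \<notin> V'" "w \<notin> \<Union>L" "w \<notin> \<Union>X2" using w DL(2) by blast+
    show "X2 \<inter> vjoin V' J' L \<subseteq> vjoin V' J' M"
    proof
      fix F assume F: "F \<in> X2 \<inter> vjoin V' J' L"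
      then have FJ: "F \<inter> V \<in> J" "\<not> {a, v} \<subseteq> F" and FL: "F - V' \<in> L" unfolding Int_iff jm by blast+
      have "F - V' \<in> M"
      proof (cases "F \<in> X")
        case True
        then have "a \<notin> F" using aX by auto
        then have e: "F - V' = F - V - {v}" by (rule V'a)
        then have "F \<in> vjoin V J (N \<union> sjoin {v} M)"
          using XB[OF True] FL FJ(1) by (simp add: vjoin_def sjoin_def)
        then consider "F - V \<in> N" | "F - V - {v} \<in> M" by (auto simp: vjoin_def sjoin_def)
        then show ?thesis
        proof cases
          case 1
          then have "v \<notin> F" using vF' DL(3) by blast
          then have "F - V - {v} = F - V" by blast
          then show ?thesis using 1 FL e glue.hyps(4) by auto
        qed (use e in simp)
      next
        case False
        then have "F - V - {a} \<in> N" using F by (auto simp: X2_def vjoin_def sjoin_def)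
        moreover from this have "F - V' = F - V - {a}" using vF DL(3) V'v by blast
        ultimately show ?thesis using FL glue.hyps(4) by auto
      qed
      then show "F \<in> vjoin V' J' M" using FJ unfolding jm by blast
    qed
  qed
  also have "vjoin V' J' (sjoin {w} M) \<union> X2 = vjoin V J (sjoin {w} (bjoin {a, v} M)) \<union> X2"
  proof -
    have 1: "F - V - {w} - {a, v} = F - V' - {w}" for F unfolding V'_def by blast
    have 2: "{a, v} \<subseteq> F - V - {w} \<longleftrightarrow> {a, v} \<subseteq> F" for F
      using w' vV(1) aV by auto
    have "vjoin V' J' (sjoin {w} M) = vjoin V J (sjoin {w} (bjoin {a, v} M))"
    proof (rule Set.set_eqI)
      fix F
      show "F \<in> vjoin V' J' (sjoin {w} M) \<longleftrightarrow> F \<in> vjoin V J (sjoin {w} (bjoin {a, v} M))"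
        unfolding jm unfolding vjoin_def bjoin_def sjoin_def mem_Collect_eq 1 2 by blast
    qed
    then show ?thesis by simp
  qed
  \<comment> \<open>The subdivision is undone by reading \<open>stellar_vjoin\<close> from right to
    left with \<open>{a, v}\<close> for \<open>\<sigma>\<close> and \<open>M\<close> for
    \<open>E\<close>. The edge joined with \<open>M\<close> is then the cone from \<open>a\<close>
    over \<open>sjoin {v} M\<close>.\<close>
  also have "geometric_realization (vjoin V J (sjoin {w} (bjoin {a, v} M)) \<union> X2) homeomorphic_space
      geometric_realization (vjoin V J (sjoin {a, v} M) \<union> X2)"
  proof (rule homeomorphic_space_sym[THEN iffD1, OF stellar_vjoin])
    show "X2 \<inter> vjoin V J (sjoin {a, v} M) \<subseteq> vjoin V J (bjoin {a, v} M)"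
    proof
      fix F assume F: "F \<in> X2 \<inter> vjoin V J (sjoin {a, v} M)"
      have "\<not> {a, v} \<subseteq> F"
        using F aX vF[of F] DL(3) unfolding X2_def vjoin_def sjoin_def by blast
      then show "F \<in> vjoin V J (bjoin {a, v} M)" using F by (auto simp: vjoin_def sjoin_def bjoin_def)
    qed
    show "V \<inter> {a, v} = {}" "w \<notin> {a, v}" "w \<notin> V" using aV vV(1) w' by auto
    have "\<Union>M \<subseteq> \<Union>D" using DL(2,4) by (intro Union_mono) blast
    moreover have "V \<inter> A = {}" "A \<inter> {a, v} = {}" "w \<notin> A"
      if "A \<subseteq> C" "V \<inter> C = {}" "a \<notin> C" "v \<notin> C" "w \<notin> C" for A C
      using that by blast+
    ultimately show "V \<inter> \<Union>M = {}" "\<Union>M \<inter> {a, v} = {}" "w \<notin> \<Union>M" using vV(2,4) vD w'(4) by metis+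
    show "M \<noteq> {}" "w \<notin> \<Union>X2" using DL(9) w' by auto
  qed (use J fc DL in simp_all)
  also have "vjoin V J (sjoin {a, v} M) \<union> X2 = vjoin V J (sjoin {a} (N \<union> sjoin {v} M)) \<union> X"
  proof -
    have "F - V - {a, v} = F - V - {a} - {v}" for F by auto
    then show ?thesis unfolding X2_def by (auto simp: vjoin_def sjoin_def)
  qed
  finally show ?case .
qed

lemma pball_homeomorphic:
  fixes D :: "nat set set"
  assumes "pball D B" "fin_complex X" "a \<notin> \<Union>D" "a \<notin> \<Union>X" "X \<inter> D \<subseteq> B"
  shows "geometric_realization (D \<union> X) homeomorphic_space geometric_realization (sjoin {a} B \<union> X)"
proof -
  have j: "vjoin {} {{}} E = E" for E :: "nat set set" by (auto simp: vjoin_def)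
  have "fin_complex {{}}" by (auto simp: abstract_simplicial_complex_def)
  then show ?thesis using pball_replace_by_cone[OF assms(1), of "{}" "{{}}" X a] assms by (simp add: j)
qed

text \<open>With an empty context, exchanging \<open>D\<close> for a cone shows that it is
  contractible, which no \<open>nsphere n\<close> is. The remaining sphere \<open>{{}}\<close> is
  excluded because every \<open>pball\<close> has a vertex.\<close>

lemma pball_not_sphere:
  fixes D :: "nat set set"
  assumes "pball D B" shows "\<not> simplicial_sphere D"
proof
  assume s: "simplicial_sphere D"
  have D: "fin_complex D" "fin_complex B" "B \<subseteq> D" "{} \<in> B" using pball_complex[OF assms] by auto
  obtain a where a: "a \<notin> \<Union>D"
    using ex_new_if_finite[OF infinite_UNIV_nat fin_complex_finite_vertices[OF D(1)]] by blast
  have h: "geometric_realization D homeomorphic_space geometric_realization (sjoin {a} B)"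
    using pball_homeomorphic[OF assms, of "{}" a] a by (simp add: abstract_simplicial_complex_def)
  have c: "contractible_space (geometric_realization (sjoin {a} B))"
    using contractible_cone[OF D(2,4)] a D(3) by blast
  show False
  proof (cases "D = {{}}")
    case True
    have "pball {{}} B" using assms True by simp
    then show False
    proof cases
      case (simplex E \<sigma>)
      then have "{} \<in> E" using complex_empty_in by blast
      then have "\<sigma> \<in> sjoin \<sigma> E" by (simp add: sjoin_def)
      then show False using simplex by auto
    next
      case (glue D' L N M v)
      then have "{} \<in> L" using pball_complex[OF glue(4)] by auto
      then have "{v} \<in> sjoin {v} L" by (simp add: sjoin_def)
      then show False using glue by auto
    qed
  next
    case False
    then obtain n where "geometric_realization D homeomorphic_space nsphere n"
      using s by (auto simp: simplicial_sphere_def)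
    then have "contractible_space (nsphere n)"
      using h c homeomorphic_space_contractibility by blast
    then show False using non_contractible_space_nsphere by blast
  qed
qed

section \<open>Subword complexes\<close>

lemma nths_cong:
  assumes "A \<inter> {..<length xs} = B \<inter> {..<length xs}" shows "nths xs A = nths xs B"
proof -
  have "snd p \<in> A \<longleftrightarrow> snd p \<in> B" if "p \<in> set (zip xs [0..<length xs])" for p
  proof -
    have "snd p < length xs" using that set_zip_rightD[of "fst p" "snd p" xs "[0..<length xs]"] by simp
    then show ?thesis using assms by blast
  qed
  then have "filter (\<lambda>p. snd p \<in> A) (zip xs [0..<length xs]) = filter (\<lambda>p. snd p \<in> B) (zip xs [0..<length xs])"
    by (intro filter_cong refl)
  then show ?thesis by (simp add: nths_def)
qed

lemma nths_Compl_snoc: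
  "nths (Q @ [s]) (- P) = nths Q (- P) @ (if length Q \<in> P then [] else [s])"
  by (simp add: nths_append)

lemma nths_insert_length: "nths Q (insert (length Q) A) = nths Q A"
  by (rule nths_cong) auto

lemma subseq_nths_mono:
  assumes "A \<subseteq> B" shows "subseq (nths xs A) (nths xs B)"
  using assms
proof (induction xs rule: rev_induct)
  case (snoc x xs)
  then show ?case by (auto simp: nths_append intro!: list_emb_append_mono)
qed simp

context coxeter_system
begin

abbreviation \<Delta> :: "'a list \<Rightarrow> 'a \<Rightarrow> nat set set" where "\<Delta> \<equiv> subword_complex G S"

section \<open>Faces of subword complexes and recursion on the last letter\<close>

lemma subword_complex_iff:
  "P \<in> \<Delta> Q x \<longleftrightarrow> P \<subseteq> {..<length Q} \<and> x \<in> subs (nths Q (- P))"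
proof -
  have "nths Q ({..<length Q} - P) = nths Q (- P)" by (rule nths_cong) auto
  then show ?thesis by (simp add: subword_complex_def subs_def)
qed

lemma subs_nths_mono: "P' \<subseteq> P \<Longrightarrow> subs (nths Q (- P)) \<subseteq> subs (nths Q (- P'))"
  by (intro subs_mono subseq_nths_mono) auto

lemma subs_nths_subset: "subs (nths Q A) \<subseteq> subs Q"
  by (rule subs_mono) (auto simp: subseq_conv_nths)

lemma nths_in_lists: "Q \<in> lists S \<Longrightarrow> nths Q A \<in> lists S"
  using set_nths_subset[of Q A] by (auto simp: lists_eq_set)

lemma fin_complex_subword: "fin_complex (\<Delta> Q x)"
proof
  show "abstract_simplicial_complex (\<Delta> Q x)" unfolding abstract_simplicial_complex_def
  proof (intro ballI conjI allI impI)
    fix F assume F: "F \<in> \<Delta> Q x"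
    then show "finite F" by (auto simp: subword_complex_iff intro: finite_subset)
    fix F' assume "F' \<subseteq> F"
    then show "F' \<in> \<Delta> Q x" using F subs_nths_mono[of F' F Q] by (auto simp: subword_complex_iff)
  qed
  have "\<Delta> Q x \<subseteq> Pow {..<length Q}" by (auto simp: subword_complex_iff)
  then show "finite (\<Delta> Q x)" by (rule finite_subset) simp
qed

lemma subword_vertices: "\<Union>(\<Delta> Q x) \<subseteq> {..<length Q}"
  by (auto simp: subword_complex_iff)

text \<open>\<open>dem P\<close> is squeezed: it is at least as long as \<open>x\<close>, which lies
  in \<open>subs P\<close>, and as an element of \<open>subs Q\<close> it is \<open>x\<close> or
  shorter than \<open>x\<close>.\<close>

lemma dem_eq_mono:
  assumes "P \<in> lists S" "Q \<in> lists S" "subs P \<subseteq> subs Q" "x \<in> subs P" "dem Q = x"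
  shows "dem P = x"
  using subs_length[OF assms(1,4)] subs_length[OF assms(2), of "dem P"] dem_in_subs[OF assms(1)] assms(3,5)
  by force

lemma subword_complex_snoc_ascent:
  assumes "s \<in> S" "x \<in> carrier G" "\<not> len (x \<otimes> s) < len x"
  shows "\<Delta> (Q @ [s]) x = sjoin {length Q} (\<Delta> Q x)"
proof (rule Set.set_eqI)
  fix F
  have "F \<subseteq> {..<Suc (length Q)} \<longleftrightarrow> F - {length Q} \<subseteq> {..<length Q}" by (auto simp: less_Suc_eq)
  then show "F \<in> \<Delta> (Q @ [s]) x \<longleftrightarrow> F \<in> sjoin {length Q} (\<Delta> Q x)"
    using assms by (auto simp: subword_complex_iff sjoin_def nths_insert_length nths_Compl_snoc subs_snoc)
qed

lemma subword_complex_descent_mono: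
  assumes "s \<in> S" "len (x \<otimes> s) < len x"
  shows "\<Delta> Q x \<subseteq> \<Delta> Q (x \<otimes> s)"
  using subs_descent[OF _ assms] by (auto simp: subword_complex_iff)

text \<open>A face containing the last position must leave all of \<open>x\<close> to be spelled by
  \<open>Q\<close>; any other face keeps the letter \<open>s\<close>, so that only
  \<open>x s\<close> remains to be spelled. By exchange the base of the cone is contained in the
  other part.\<close>

lemma subword_complex_snoc_descent:
  assumes "s \<in> S" "x \<in> carrier G" "len (x \<otimes> s) < len x"
  shows "\<Delta> (Q @ [s]) x = \<Delta> Q (x \<otimes> s) \<union> sjoin {length Q} (\<Delta> Q x)"
proof (rule Set.set_eqI)
  fix F
  have sub: "F \<subseteq> {..<Suc (length Q)} \<longleftrightarrow> F - {length Q} \<subseteq> {..<length Q}" by (auto simp: less_Suc_eq)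
  show "F \<in> \<Delta> (Q @ [s]) x \<longleftrightarrow> F \<in> \<Delta> Q (x \<otimes> s) \<union> sjoin {length Q} (\<Delta> Q x)"
  proof (cases "length Q \<in> F")
    case True
    then have "\<not> F \<subseteq> {..<length Q}" by auto
    then show ?thesis using True sub
      by (simp add: subword_complex_iff sjoin_def nths_insert_length nths_Compl_snoc)
  next
    case False
    then have "F - {length Q} = F" by simp
    then show ?thesis using False sub assms subs_descent[OF _ assms(1,3)]
      by (auto simp: subword_complex_iff sjoin_def nths_Compl_snoc nths_insert_length subs_snoc)
  qed
qed

section \<open>Balls and spheres among subword complexes\<close>

definition boundary :: "'a list \<Rightarrow> 'a \<Rightarrow> nat set set" where
  "boundary Q x = {P \<in> \<Delta> Q x. dem (nths Q (- P)) \<noteq> x}"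

lemma boundary_empty:
  assumes "Q \<in> lists S" "dem Q = x" shows "boundary Q x = {}"
proof -
  have "dem (nths Q (- P)) = x" if "P \<in> \<Delta> Q x" for P
  proof (rule dem_eq_mono[OF nths_in_lists[OF assms(1)] assms(1) subs_nths_subset _ assms(2)])
    show "x \<in> subs (nths Q (- P))" using that by (simp add: subword_complex_iff)
  qed
  then show ?thesis by (auto simp: boundary_def)
qed

text \<open>At an ascent the complex is a cone over a sphere or a ball. At a descent
  \<open>dem Q\<close> is neither \<open>x\<close> nor \<open>x s\<close>, so both parts of the
  decomposition are balls unless the smaller one is void. The smaller one lies in the boundary of
  the other, because the words left by its faces have Demazure products at least as long as
  \<open>x\<close>.\<close>

lemma subword_pball:
  "\<lbrakk>Q \<in> lists S; x \<in> subs Q; dem Q \<noteq> x\<rbrakk> \<Longrightarrow> pball (\<Delta> Q x) (boundary Q x)"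
proof (induction Q arbitrary: x rule: rev_induct)
  case Nil
  then show ?case by (simp add: subs_Nil)
next
  case (snoc s Q)
  let ?n = "length Q"
  have Q: "Q \<in> lists S" "s \<in> S" and x: "x \<in> carrier G" using snoc.prems subs_closed by auto
  have dl: "dem (nths Q (- P)) \<in> carrier G" for P using nths_in_lists Q by simp
  have nv: "?n \<notin> \<Union>(\<Delta> Q y)" for y using subword_vertices[of Q y] by auto
  have nF: "F \<in> \<Delta> Q y \<Longrightarrow> ?n \<notin> F" for F y using nv by blast
  show ?case
  proof (cases "len (x \<otimes> s) < len x")
    case False
    have D: "\<Delta> (Q @ [s]) x = sjoin {?n} (\<Delta> Q x)" by (rule subword_complex_snoc_ascent[OF Q(2) x False])
    have xQ: "x \<in> subs Q" using snoc.prems Q x False by (simp add: subs_snoc)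
    \<comment> \<open>Every value of \<open>dmult\<close> with last argument \<open>s\<close> has
      \<open>s\<close> as a descent, and \<open>x\<close> has not. So each face that keeps the last
      letter lies in the boundary.\<close>
    have asc: "dmult y s \<noteq> x" if "y \<in> carrier G" for y
      using dmult_descent[OF that Q(2)] False by auto
    have B: "boundary (Q @ [s]) x = \<Delta> Q x \<union> sjoin {?n} (boundary Q x)"
    proof (rule Set.set_eqI)
      fix F
      show "F \<in> boundary (Q @ [s]) x \<longleftrightarrow> F \<in> \<Delta> Q x \<union> sjoin {?n} (boundary Q x)"
      proof (cases "?n \<in> F")
        case True
        then have "F \<notin> \<Delta> Q x" using nF by blast
        then show ?thesis using True unfolding boundary_def D
          by (simp add: sjoin_def nths_Compl_snoc nths_insert_length)
      next
        case n: False
        then have "F - {?n} = F" by simp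
        then show ?thesis using n asc[OF dl] unfolding boundary_def D
          by (auto simp: sjoin_def nths_Compl_snoc nths_insert_length)
      qed
    qed
    show ?thesis
    proof (cases "dem Q = x")
      case True
      \<comment> \<open>The cone over a sphere is an instance of the base rule: for the single new
        vertex \<open>?n\<close>, \<open>bjoin {?n}\<close> gives back the sphere itself.\<close>
      have "{} \<in> \<Delta> Q x" using xQ by (simp add: subword_complex_iff nths_all)
      then have "pball (sjoin {?n} (\<Delta> Q x)) (bjoin {?n} (\<Delta> Q x))"
        using nv by (intro pball.simplex fin_complex_subword) auto
      moreover have "bjoin {?n} (\<Delta> Q x) = \<Delta> Q x"
      proof (rule Set.set_eqI)
        fix F
        show "F \<in> bjoin {?n} (\<Delta> Q x) \<longleftrightarrow> F \<in> \<Delta> Q x"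
          using nF[of F x] by (cases "?n \<in> F") (auto simp: bjoin_def)
      qed
      moreover have "sjoin {?n} (boundary Q x) = {}" using boundary_empty[OF Q(1) True] by (simp add: sjoin_def)
      ultimately show ?thesis unfolding D B by simp
    next
      case False
      then have "pball (\<Delta> Q x) (boundary Q x)" using snoc.IH[OF Q(1) xQ] by simp
      from pball_cone[OF this nv] show ?thesis unfolding D B .
    qed
  next
    case True
    let ?y = "x \<otimes> s"
    have y: "?y \<in> carrier G" using x Q by simp
    have D: "\<Delta> (Q @ [s]) x = \<Delta> Q ?y \<union> sjoin {?n} (\<Delta> Q x)"
      by (rule subword_complex_snoc_descent[OF Q(2) x True])
    have yQ: "?y \<in> subs Q" using snoc.prems Q x True by (simp add: subs_snoc)
    have dm: "dmult z s = x \<longleftrightarrow> z = x \<or> z = ?y" if "z \<in> carrier G" for z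
      using dmult_eq_iff[OF that x Q(2) True] .
    have dQ: "dem Q \<noteq> ?y" "dem Q \<noteq> x" using snoc.prems dm[of "dem Q"] Q by auto
    have pD: "pball (\<Delta> Q ?y) (boundary Q ?y)" using snoc.IH[OF Q(1) yQ dQ(1)] .
    \<comment> \<open>Boundary faces of \<open>\<Delta> Q ?y\<close> with Demazure product
      \<open>x\<close> are the interior faces of the piece \<open>\<Delta> Q x\<close> along which
      the cone is attached. The others form the complementary piece, which has to be closed under
      subsets and to meet \<open>\<Delta> Q x\<close> in its boundary.\<close>
    define N where "N = {P \<in> boundary Q ?y. dem (nths Q (- P)) \<noteq> x}"
    have memN: "P \<in> N \<longleftrightarrow> P \<in> \<Delta> Q ?y \<and> dem (nths Q (- P)) \<noteq> ?y \<and> dem (nths Q (- P)) \<noteq> x" for P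
      by (auto simp: N_def boundary_def)
    have demL: "dem (nths Q (- P)) \<noteq> ?y" if "P \<in> \<Delta> Q x" for P
    proof
      assume "dem (nths Q (- P)) = ?y"
      then show False using that subs_length[OF nths_in_lists[OF Q(1)], of x "- P"] True
        by (auto simp: subword_complex_iff)
    qed
    have B: "boundary (Q @ [s]) x = N \<union> sjoin {?n} (boundary Q x)"
    proof (rule Set.set_eqI)
      fix F
      show "F \<in> boundary (Q @ [s]) x \<longleftrightarrow> F \<in> N \<union> sjoin {?n} (boundary Q x)"
      proof (cases "?n \<in> F")
        case T: True
        then have "F \<notin> \<Delta> Q ?y" using nF by blast
        then show ?thesis using T unfolding boundary_def D N_def
          by (simp add: sjoin_def nths_Compl_snoc nths_insert_length)
      next
        case n: False
        then have e: "F - {?n} = F" by simp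
        have "F \<in> \<Delta> Q ?y" if "F \<in> \<Delta> Q x" using that subword_complex_descent_mono[OF Q(2) True] by blast
        then show ?thesis using n e demL[of F] dm[OF dl] unfolding Un_iff memN unfolding boundary_def D
          by (auto simp: sjoin_def nths_Compl_snoc nths_insert_length)
      qed
    qed
    have LD: "\<Delta> Q x \<subseteq> \<Delta> Q ?y" by (rule subword_complex_descent_mono[OF Q(2) True])
    show ?thesis
    proof (cases "x \<in> subs Q")
      case False
      have "\<not> x \<in> subs (nths Q (- P))" for P
        using False subs_nths_subset by blast
      then have E: "\<Delta> Q x = {}" "\<And>P. dem (nths Q (- P)) \<noteq> x"
        using dem_in_subs[OF nths_in_lists[OF Q(1)]] by (auto simp: subword_complex_iff)
      then have "N = boundary Q ?y" "sjoin {?n} (boundary Q x) = {}" "sjoin {?n} (\<Delta> Q x) = {}"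
        by (auto simp: N_def boundary_def sjoin_def)
      then show ?thesis unfolding D B using pD by simp
    next
      case xQ: True
      have pL: "pball (\<Delta> Q x) (boundary Q x)" using snoc.IH[OF Q(1) xQ dQ(2)] .
      have 1: "boundary Q ?y = \<Delta> Q x \<union> N"
      proof (rule Set.set_eqI)
        fix P
        have "P \<in> \<Delta> Q x" if "P \<in> \<Delta> Q ?y" "dem (nths Q (- P)) = x"
          using that dem_in_subs[OF nths_in_lists[OF Q(1), of "- P"]] by (auto simp: subword_complex_iff)
        then show "P \<in> boundary Q ?y \<longleftrightarrow> P \<in> \<Delta> Q x \<union> N"
          using LD demL[of P] unfolding Un_iff memN unfolding boundary_def by blast
      qed
      have 2: "\<Delta> Q x \<inter> N = boundary Q x"
        using LD demL unfolding memN boundary_def Int_def by blast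
      have 3: "fin_complex N"
      proof (rule fin_complex_sub[OF fin_complex_subword])
        show "N \<subseteq> \<Delta> Q ?y" using memN by blast
        fix F F' assume F: "F \<in> N" "F' \<subseteq> F"
        have F'D: "F' \<in> \<Delta> Q ?y" using complexD[of "\<Delta> Q ?y" F F'] F memN fin_complex_subword by blast
        let ?u = "nths Q (- F)" and ?u' = "nths Q (- F')"
        have u: "?u \<in> lists S" "?u' \<in> lists S" using nths_in_lists Q by auto
        have sub: "subs ?u \<subseteq> subs ?u'" using F by (intro subs_nths_mono)
        have yu: "?y \<in> subs ?u" "dem ?u \<noteq> ?y" "dem ?u \<noteq> x" using F memN by (auto simp: subword_complex_iff)
        have "dem ?u' \<noteq> ?y" using dem_eq_mono[OF u sub yu(1)] yu(2) by blast
        moreover have "dem ?u' \<noteq> x"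
        proof
          assume e: "dem ?u' = x"
          \<comment> \<open>The length of \<open>dem ?u\<close> would lie strictly between those of
            \<open>x s\<close> and \<open>x\<close>, which differ by one.\<close>
          have "len ?y < len (dem ?u)" using subs_length[OF u(1) yu(1)] yu(2) by auto
          moreover have "len (dem ?u) < len x"
            using subs_length[OF u(2), of "dem ?u"] dem_in_subs[OF u(1)] sub e yu(3) by auto
          moreover have "len x = len ?y + 1" using cox_length_mult_gen_cases[OF x Q(2)] True by auto
          ultimately show False by simp
        qed
        ultimately show "F' \<in> N" using F'D memN by blast
      qed
      show ?thesis unfolding D B
        by (rule pball.glue[OF _ pL 3 2 nv]) (use pD 1 in simp)
    qed
  qed
qed

text \<open>The last letter is a descent of \<open>x\<close>. If \<open>dem Q = x s\<close>, then
  \<open>x\<close> is not spelled in \<open>Q\<close> and the complex is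
  \<open>\<Delta> Q (x s)\<close>. If \<open>dem Q = x\<close>, the sphere
  \<open>\<Delta> Q x\<close> is the whole boundary of the ball \<open>\<Delta> Q (x s)\<close>, and
  trading this ball for a cone turns the union into a suspension.\<close>

lemma subword_sphere:
  "\<lbrakk>Q \<in> lists S; dem Q = x\<rbrakk> \<Longrightarrow> simplicial_sphere (\<Delta> Q x)"
proof (induction Q arbitrary: x rule: rev_induct)
  case Nil
  then have "\<Delta> [] x = {{}}" by (auto simp: subword_complex_iff subs_Nil)
  then show ?case by (simp add: simplicial_sphere_def abstract_simplicial_complex_def)
next
  case (snoc s Q)
  let ?n = "length Q" and ?y = "x \<otimes> s"
  have Q: "Q \<in> lists S" "s \<in> S" and x: "x \<in> carrier G" using snoc.prems dem_closed by auto
  have dx: "dmult (dem Q) s = x" using snoc.prems by simp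
  have desc: "len ?y < len x" using dmult_descent[of "dem Q" s] Q dx by simp
  have D: "\<Delta> (Q @ [s]) x = \<Delta> Q ?y \<union> sjoin {?n} (\<Delta> Q x)"
    by (rule subword_complex_snoc_descent[OF Q(2) x desc])
  have nv: "?n \<notin> \<Union>(\<Delta> Q z)" for z using subword_vertices[of Q z] by auto
  consider "dem Q = ?y" | "dem Q = x" using dmult_eq_iff[of "dem Q" x s] Q x desc dx by auto
  then show ?case
  proof cases
    case 1
    have "\<not> x \<in> subs Q" using subs_length[OF Q(1), of x] 1 desc by auto
    then have "\<Delta> Q x = {}"
      using subs_nths_subset[of Q] unfolding set_eq_iff subword_complex_iff by blast
    then have "\<Delta> (Q @ [s]) x = \<Delta> Q ?y" unfolding D by (simp add: sjoin_def)
    then show ?thesis using snoc.IH[OF Q(1) 1] by simp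
  next
    case 2
    have sph: "simplicial_sphere (\<Delta> Q x)" by (rule snoc.IH[OF Q(1) 2])
    have "x \<in> subs Q" using dem_in_subs[OF Q(1)] 2 by simp
    then have "?y \<in> subs Q" by (rule subs_descent[OF _ Q(2) desc])
    then have pb: "pball (\<Delta> Q ?y) (boundary Q ?y)"
      by (rule subword_pball[OF Q(1)]) (use 2 desc in auto)
    have bdy: "boundary Q ?y = \<Delta> Q x"
    proof (rule Set.set_eqI)
      fix P
      let ?u = "nths Q (- P)"
      have u: "?u \<in> lists S" using nths_in_lists Q by auto
      have sub: "subs ?u \<subseteq> subs Q" by (rule subs_nths_subset)
      have lx: "len x = len ?y + 1" using cox_length_mult_gen_cases[OF x Q(2)] desc by auto
      show "P \<in> boundary Q ?y \<longleftrightarrow> P \<in> \<Delta> Q x"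
      proof
        assume "P \<in> boundary Q ?y"
        then have P: "P \<subseteq> {..<?n}" "?y \<in> subs ?u" "dem ?u \<noteq> ?y" by (auto simp: boundary_def subword_complex_iff)
        \<comment> \<open>\<open>dem ?u\<close> is longer than \<open>x s\<close>, and as an element
          of \<open>subs Q\<close> it is \<open>x\<close> or shorter than \<open>x\<close>. The
          length gap of one leaves only \<open>x\<close>.\<close>
        then have "len ?y < len (dem ?u)" using subs_length[OF u P(2)] by auto
        moreover have "dem ?u = x \<or> len (dem ?u) < len x"
          using subs_length[OF Q(1), of "dem ?u"] dem_in_subs[OF u] sub 2 by auto
        ultimately have "dem ?u = x" using lx by auto
        then show "P \<in> \<Delta> Q x" using P dem_in_subs[OF u] by (simp add: subword_complex_iff)
      next
        assume P: "P \<in> \<Delta> Q x"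
        then have "P \<in> \<Delta> Q ?y" using subword_complex_descent_mono[OF Q(2) desc] by blast
        moreover have "dem ?u \<noteq> ?y" using P subs_length[OF u, of x] desc by (auto simp: subword_complex_iff)
        ultimately show "P \<in> boundary Q ?y" by (simp add: boundary_def)
      qed
    qed
    define a where "a = Suc ?n"
    have a: "a \<notin> \<Union>(\<Delta> Q z)" for z using subword_vertices[of Q z] by (auto simp: a_def)
    have an: "a \<noteq> ?n" by (simp add: a_def)
    have aF: "a \<notin> F" if "F - {?n} \<in> \<Delta> Q x" for F using that a[of x] an by blast
    have nF: "?n \<notin> F" if "F - {a} \<in> \<Delta> Q x" for F using that nv[of x] an by blast
    let ?X = "sjoin {?n} (\<Delta> Q x)"
    have "geometric_realization (\<Delta> Q ?y \<union> ?X) homeomorphic_space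
        geometric_realization (sjoin {a} (\<Delta> Q x) \<union> ?X)"
    proof (rule pball_homeomorphic[OF pb[unfolded bdy] fin_complex_cone[OF fin_complex_subword] a])
      show "a \<notin> \<Union>?X" using aF by (auto simp: sjoin_def)
      show "?X \<inter> \<Delta> Q ?y \<subseteq> \<Delta> Q x"
      proof
        fix F assume F: "F \<in> ?X \<inter> \<Delta> Q ?y"
        then have "?n \<notin> F" using nv by blast
        then have "F - {?n} = F" by simp
        then show "F \<in> \<Delta> Q x" using F by (simp add: sjoin_def)
      qed
    qed
    also have "sjoin {a} (\<Delta> Q x) \<union> ?X = bjoin {a, ?n} (\<Delta> Q x)"
    proof (rule Set.set_eqI)
      fix F
      have "?n \<notin> F \<Longrightarrow> F - {a, ?n} = F - {a}" "a \<notin> F \<Longrightarrow> F - {a, ?n} = F - {?n}" by auto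
      then show "F \<in> sjoin {a} (\<Delta> Q x) \<union> ?X \<longleftrightarrow> F \<in> bjoin {a, ?n} (\<Delta> Q x)"
        using aF[of F] nF[of F] unfolding sjoin_def bjoin_def Un_iff mem_Collect_eq
        by (metis insert_subset empty_subsetI)
    qed
    finally have h: "geometric_realization (\<Delta> (Q @ [s]) x) homeomorphic_space
        geometric_realization (bjoin {a, ?n} (\<Delta> Q x))" unfolding D .
    from simplicial_sphere_suspension[OF sph an a nv] obtain m
      where "geometric_realization (bjoin {a, ?n} (\<Delta> Q x)) homeomorphic_space nsphere m" by blast
    with h have "geometric_realization (\<Delta> (Q @ [s]) x) homeomorphic_space nsphere m"
      by (rule homeomorphic_space_trans)
    then show ?thesis using fin_complex_subword[of "Q @ [s]" x] unfolding simplicial_sphere_def by metis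
  qed
qed

lemma sphere_dem:
  assumes Q: "Q \<in> lists S" and s: "simplicial_sphere (\<Delta> Q x)"
  shows "dem Q = x"
proof (rule ccontr)
  assume "dem Q \<noteq> x"
  moreover have "x \<in> subs Q"
  proof -
    have "\<Delta> Q x \<noteq> {}"
    proof
      assume e: "\<Delta> Q x = {}"
      then obtain n where h: "geometric_realization (\<Delta> Q x) homeomorphic_space nsphere n"
        using s by (auto simp: simplicial_sphere_def)
      \<comment> \<open>The void complex has an empty realization, which counts as contractible and
        so is no \<open>nsphere n\<close> either.\<close>
      have "realization_set (\<Delta> Q x) = {}" by (simp add: e realization_set_def)
      then have "contractible_space (geometric_realization (\<Delta> Q x))"
        unfolding geometric_realization_eq by simp
      then show False
        using homeomorphic_space_contractibility[OF h] non_contractible_space_nsphere[of n] by simp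
    qed
    then have "{} \<in> \<Delta> Q x" using complex_empty_in fin_complex_subword by blast
    then show ?thesis by (simp add: subword_complex_iff nths_all)
  qed
  ultimately have "pball (\<Delta> Q x) (boundary Q x)" by (intro subword_pball[OF Q])
  from pball_not_sphere[OF this] show False using s by contradiction
qed

text \<open>Every reduced word for \<open>w\<^sub>0\<close> in \<open>Q @ R\<close> has its part in \<open>Q\<close> no longer than \<open>x = dem Q\<close>, so
  it uses all of \<open>R\<close>.\<close>

lemma subword_complex_extend:
  assumes Q: "Q \<in> lists S" and R: "R \<in> lists S" and x: "dem Q = x"
    and z: "x \<otimes> wp R = z" "len x + length R = len z"
  shows "\<Delta> (Q @ R) z = \<Delta> Q x"
proof (rule Set.set_eqI)
  fix P
  let ?n = "length Q"
  define R' where "R' = nths R {j. j + ?n \<in> - P}"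
  have split: "nths (Q @ R) (- P) = nths Q (- P) @ R'" by (simp add: nths_append R'_def)
  show "P \<in> \<Delta> (Q @ R) z \<longleftrightarrow> P \<in> \<Delta> Q x"
  proof
    assume P: "P \<in> \<Delta> (Q @ R) z"
    then obtain w where w: "subseq w (nths Q (- P) @ R')" "reduced_expression G S w z"
      using split by (auto simp: subword_complex_iff subs_def)
    obtain a b where ab: "w = a @ b" "subseq a (nths Q (- P))" "subseq b R'"
      using w(1) by (rule subseq_appendE)
    have l: "a \<in> lists S" "b \<in> lists S" "wp a \<otimes> wp b = z" "length a + length b = len z"
      using w(2) ab(1) by (auto simp: reduced_expression_def)
    have sR: "subseq R' R" unfolding R'_def by (auto simp: subseq_conv_nths)
    have lb: "length b \<le> length R'" "length R' \<le> length R"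
      using list_emb_length[OF ab(3)] list_emb_length[OF sR] by auto
    have la: "len (wp a) = length a"
    proof -
      have "len z \<le> len (wp a) + len (wp b)" using cox_length_mult_le[of "wp a" "wp b"] l by simp
      then show ?thesis using cox_length_le[OF l(1)] cox_length_le[OF l(2)] l(4) by linarith
    qed
    then have ra: "reduced_expression G S a (wp a)" using l by (simp add: reduced_expression_def)
    then have as: "wp a \<in> subs (nths Q (- P))" using ab(2) by (auto simp: subs_def)
    then have "wp a \<in> subs Q" using subs_nths_subset by blast
    then have le: "wp a = x \<or> len (wp a) < len x" using subs_length[OF Q] x by blast
    then have "length b = length R'" "length R' = length R" "wp a = x" using la lb l(4) z(2) by auto
    \<comment> \<open>A position of \<open>P\<close> beyond \<open>Q\<close> would make
      \<open>R'\<close> shorter than \<open>R\<close>.\<close>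
    moreover have "P \<subseteq> {..<?n}"
    proof (rule ccontr)
      assume "\<not> P \<subseteq> {..<?n}"
      then obtain p where p: "p \<in> P" "?n \<le> p" by (meson lessThan_iff not_le subsetI)
      then have pl: "p - ?n < length R" using P by (auto simp: subword_complex_iff)
      have "{i. i < length R \<and> i + ?n \<in> - P} \<subseteq> {..<length R} - {p - ?n}" using p by auto
      then have "card {i. i < length R \<and> i + ?n \<in> - P} \<le> card ({..<length R} - {p - ?n})"
        by (intro card_mono) auto
      also have "\<dots> < length R" using pl by simp
      finally show False using \<open>length R' = length R\<close> by (simp add: R'_def length_nths)
    qed
    ultimately show "P \<in> \<Delta> Q x" using as by (simp add: subword_complex_iff)
  next
    assume P: "P \<in> \<Delta> Q x"
    then have Pn: "P \<subseteq> {..<?n}" by (simp add: subword_complex_iff)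
    then have "R' = R" unfolding R'_def by (intro nths_all) auto
    obtain a where a: "subseq a (nths Q (- P))" "reduced_expression G S a x"
      using P by (auto simp: subword_complex_iff subs_def)
    have "reduced_expression G S (a @ R) z"
      using a(2) R z by (auto simp: reduced_expression_def)
    moreover have "subseq (a @ R) (nths (Q @ R) (- P))"
      unfolding split \<open>R' = R\<close> by (intro list_emb_append_mono a) simp
    ultimately show "P \<in> \<Delta> (Q @ R) z" using Pn by (auto simp: subword_complex_iff subs_def)
  qed
qed

end

section \<open>Links and isomorphisms\<close>

lemma simplicial_isomorphic_image:
  assumes "inj_on f U" "\<Union>K \<subseteq> U"
  shows "simplicial_isomorphic K ((\<lambda>F. f ` F) ` K)"
proof -
  have "bij_betw f (\<Union>K) (\<Union>((\<lambda>F. f ` F) ` K))"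
    using inj_on_subset[OF assms] by (auto simp: bij_betw_def)
  then show ?thesis unfolding simplicial_isomorphic_def by (intro exI[of _ f]) simp
qed

lemma simplicial_isomorphic_sym:
  assumes "simplicial_isomorphic K L" shows "simplicial_isomorphic L K"
proof -
  obtain f where f: "bij_betw f (\<Union>K) (\<Union>L)" "(\<lambda>F. f ` F) ` K = L"
    using assms by (auto simp: simplicial_isomorphic_def)
  let ?g = "inv_into (\<Union>K) f"
  have "?g ` (f ` F) = F" if "F \<in> K" for F
    using that f(1) by (intro inv_into_image_cancel) (auto simp: bij_betw_def)
  then have "(\<lambda>F. ?g ` F) ` L = (\<lambda>F. F) ` K"
    unfolding f(2)[symmetric] image_image by (intro image_cong refl)
  then have "(\<lambda>F. ?g ` F) ` L = K" by simp
  then show ?thesis using bij_betw_inv_into[OF f(1)] unfolding simplicial_isomorphic_def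
    by (intro exI[of _ ?g]) simp
qed

lemma simplicial_isomorphic_trans:
  assumes "simplicial_isomorphic K L" "simplicial_isomorphic L M"
  shows "simplicial_isomorphic K M"
proof -
  obtain f g where f: "bij_betw f (\<Union>K) (\<Union>L)" "(\<lambda>F. f ` F) ` K = L"
    and g: "bij_betw g (\<Union>L) (\<Union>M)" "(\<lambda>F. g ` F) ` L = M"
    using assms unfolding simplicial_isomorphic_def by metis
  have "(\<lambda>F. (g \<circ> f) ` F) ` K = (\<lambda>F. g ` F) ` ((\<lambda>F. f ` F) ` K)"
    by (simp add: image_image image_comp)
  then have "(\<lambda>F. (g \<circ> f) ` F) ` K = M" using f(2) g(2) by simp
  then show ?thesis using bij_betw_trans[OF f(1) g(1)] unfolding simplicial_isomorphic_def
    by (intro exI[of _ "g \<circ> f"]) simp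
qed

context coxeter_system
begin

lemma link_subword_complex:
  assumes F: "F \<in> \<Delta> Q x"
  shows "simplicial_isomorphic (link (\<Delta> Q x) F) (\<Delta> (nths Q (- F)) x)"
proof -
  let ?n = "length Q"
  let ?A = "{..<?n} - F"
  \<comment> \<open>\<open>rk i\<close> is the position that a surviving index \<open>i\<close> gets
    in the word left after deleting \<open>F\<close>.\<close>
  define rk where "rk = (\<lambda>i. card {j \<in> - F. j < i})"
  have rk_eq: "card {j \<in> - F. j < i} = rk i" for i by (simp add: rk_def)
  have mono: "rk i < rk j" if "i < j" "i \<notin> F" for i j
    unfolding rk_def using that by (intro psubset_card_mono) auto
  have inj: "inj_on rk ?A"
  proof (rule inj_onI)
    fix i j assume "i \<in> ?A" "j \<in> ?A" "rk i = rk j"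
    then show "i = j" using mono[of i j] mono[of j i] by (cases i j rule: linorder_cases) auto
  qed
  have len: "length (nths Q (- F)) = card ?A"
    unfolding length_nths by (intro arg_cong[of _ _ card]) auto
  have rk_lt: "rk i < card ?A" if "i \<in> ?A" for i
    unfolding rk_def using that by (intro psubset_card_mono) auto
  have im: "rk ` ?A = {..<card ?A}"
  proof (rule card_subset_eq)
    show "rk ` ?A \<subseteq> {..<card ?A}" using rk_lt by auto
    show "card (rk ` ?A) = card {..<card ?A}" using card_image[OF inj] by simp
  qed simp
  have del: "nths (nths Q (- F)) (- (rk ` H)) = nths Q (- (H \<union> F))" if H: "H \<subseteq> ?A" for H
  proof -
    have "nths (nths Q (- F)) (- (rk ` H)) = nths Q {i \<in> - F. \<exists>j\<in>- (rk ` H). card {i' \<in> - F. i' < i} = j}"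
      by (rule nths_nths)
    also have "\<dots> = nths Q (- (H \<union> F))"
    proof (rule nths_cong)
      have "rk i \<in> rk ` H \<longleftrightarrow> i \<in> H" if "i \<in> ?A" for i
        using inj_on_image_mem_iff[OF inj that H] .
      then show "{i \<in> - F. \<exists>j\<in>- (rk ` H). card {i' \<in> - F. i' < i} = j} \<inter> {..<?n} = - (H \<union> F) \<inter> {..<?n}"
        unfolding rk_eq by auto
    qed
    finally show ?thesis .
  qed
  have linkA: "H \<in> link (\<Delta> Q x) F \<longleftrightarrow> H \<subseteq> ?A \<and> x \<in> subs (nths Q (- (H \<union> F)))" for H
  proof
    assume "H \<in> link (\<Delta> Q x) F"
    then show "H \<subseteq> ?A \<and> x \<in> subs (nths Q (- (H \<union> F)))"
      unfolding link_def by (auto simp: subword_complex_iff)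
  next
    assume H: "H \<subseteq> ?A \<and> x \<in> subs (nths Q (- (H \<union> F)))"
    then have "H \<union> F \<in> \<Delta> Q x" using F unfolding subword_complex_iff by blast
    moreover from this have "H \<in> \<Delta> Q x" using complexD[of "\<Delta> Q x" "H \<union> F" H] fin_complex_subword by blast
    ultimately show "H \<in> link (\<Delta> Q x) F" using H unfolding link_def by blast
  qed
  have "(\<lambda>H. rk ` H) ` link (\<Delta> Q x) F = \<Delta> (nths Q (- F)) x"
  proof (rule Set.set_eqI)
    fix P
    show "P \<in> (\<lambda>H. rk ` H) ` link (\<Delta> Q x) F \<longleftrightarrow> P \<in> \<Delta> (nths Q (- F)) x"
    proof
      assume "P \<in> (\<lambda>H. rk ` H) ` link (\<Delta> Q x) F"
      then obtain H where H: "P = rk ` H" "H \<subseteq> ?A" "x \<in> subs (nths Q (- (H \<union> F)))"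
        using linkA by blast
      have "rk ` H \<subseteq> {..<card ?A}" using im H(2) by blast
      then show "P \<in> \<Delta> (nths Q (- F)) x"
        using H(3) unfolding subword_complex_iff len H(1) del[OF H(2)] by blast
    next
      assume P: "P \<in> \<Delta> (nths Q (- F)) x"
      then have "P \<subseteq> rk ` ?A" unfolding subword_complex_iff len im by blast
      then obtain H where H: "H \<subseteq> ?A" "P = rk ` H" by (auto simp: subset_image_iff)
      then have "x \<in> subs (nths Q (- (H \<union> F)))"
        using P del[OF H(1)] unfolding subword_complex_iff by simp
      then show "P \<in> (\<lambda>H. rk ` H) ` link (\<Delta> Q x) F" using linkA H by blast
    qed
  qed
  moreover have "\<Union>(link (\<Delta> Q x) F) \<subseteq> ?A" using linkA by blast
  ultimately show ?thesis using simplicial_isomorphic_image[OF inj] by metis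
qed

end

theorem theorem2p15:
  fixes G :: "('a, 'b) monoid_scheme" and S :: "'a set" and K :: "'v set set"
  assumes "coxeter_system G S" and "finite (carrier G)"
    and "abstract_simplicial_complex K"
  shows "(\<exists>Q x. Q \<in> lists S \<and> x \<in> carrier G \<and>
             simplicial_sphere (subword_complex G S Q x) \<and>
             simplicial_isomorphic K (subword_complex G S Q x))
     \<longleftrightarrow> (\<exists>k c cw F. coxeter_element G S c \<and> reduced_expression G S cw c \<and>
             F \<in> multi_cluster_complex G S k cw \<and>
             simplicial_isomorphic K (link (multi_cluster_complex G S k cw) F))"
proof -
  interpret coxeter_system G S by fact
  note fin = \<open>finite (carrier G)\<close>
  let ?w = "longest_element G S"
  show ?thesis
  proof
    assume "\<exists>Q x. Q \<in> lists S \<and> x \<in> carrier G \<and> simplicial_sphere (subword_complex G S Q x) \<and>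
             simplicial_isomorphic K (subword_complex G S Q x)"
    then obtain Q x where Q: "Q \<in> lists S" and x: "x \<in> carrier G"
      and sph: "simplicial_sphere (subword_complex G S Q x)"
      and iso: "simplicial_isomorphic K (subword_complex G S Q x)" by blast
    have dem: "dem Q = x" by (rule sphere_dem[OF Q sph])
    from longest_extend[OF fin x] obtain R where R: "R \<in> lists S" "x \<otimes>\<^bsub>G\<^esub> wp R = ?w"
      "len x + length R = len ?w" by blast
    have ext: "subword_complex G S (Q @ R) ?w = subword_complex G S Q x"
      by (rule subword_complex_extend[OF Q R(1) dem R(2,3)])
    obtain c0 where c0: "set c0 = S" "distinct c0"
      using finite_distinct_list[OF gens_finite[OF fin]] by blast
    define c where "c = wp c0"
    have cox: "coxeter_element G S c" unfolding coxeter_element_def c_def using c0 by blast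
    have "c0 \<in> lists S" using c0 by (simp add: lists_eq_set)
    then have "c \<in> carrier G" by (simp add: c_def)
    from reduced_exists[OF this] obtain cw where cw: "reduced_expression G S cw c" by blast
    have supp: "set cw = S" by (rule coxeter_element_support[OF fin cox cw])
    \<comment> \<open>Since \<open>set cw = S\<close>, one copy of \<open>cw\<close> for each letter
      makes room for the whole word.\<close>
    define k where "k = length (Q @ R)"
    define T where "T = concat (replicate k cw) @ c_sorting_word G S cw"
    have "Q @ R \<in> lists (set cw)" using Q R(1) supp by simp
    then have "subseq (Q @ R) (concat (replicate k cw))" unfolding k_def by (rule subseq_power)
    then have "subseq (Q @ R) T" unfolding T_def by (rule list_emb_prefix)
    then obtain A where A: "Q @ R = nths T A" by (auto simp: subseq_conv_nths)
    \<comment> \<open>Deleting the positions outside an embedding of \<open>Q @ R\<close> leaves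
      exactly this word, so the link of \<open>F\<close> is its subword complex up to
      renumbering.\<close>
    define F where "F = {..<length T} - A"
    have TF: "nths T (- F) = Q @ R" unfolding A by (rule nths_cong) (auto simp: F_def)
    have "{} \<in> subword_complex G S Q x"
      using dem_in_subs[OF Q] dem by (simp add: subword_complex_iff nths_all)
    then have "{} \<in> subword_complex G S (Q @ R) ?w" using ext by simp
    then have "?w \<in> subs (Q @ R)" by (simp add: subword_complex_iff nths_all)
    then have F: "F \<in> subword_complex G S T ?w" unfolding subword_complex_iff TF by (auto simp: F_def)
    have "simplicial_isomorphic (link (subword_complex G S T ?w) F) (subword_complex G S Q x)"
      using link_subword_complex[OF F] unfolding TF ext .
    then have "simplicial_isomorphic K (link (subword_complex G S T ?w) F)"
      using iso simplicial_isomorphic_sym simplicial_isomorphic_trans by metis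
    then have "F \<in> multi_cluster_complex G S k cw"
      "simplicial_isomorphic K (link (multi_cluster_complex G S k cw) F)"
      using F unfolding multi_cluster_complex_def T_def by simp_all
    with cox cw show "\<exists>k c cw F. coxeter_element G S c \<and> reduced_expression G S cw c \<and>
             F \<in> multi_cluster_complex G S k cw \<and>
             simplicial_isomorphic K (link (multi_cluster_complex G S k cw) F)" by metis
  next
    assume "\<exists>k c cw F. coxeter_element G S c \<and> reduced_expression G S cw c \<and>
             F \<in> multi_cluster_complex G S k cw \<and>
             simplicial_isomorphic K (link (multi_cluster_complex G S k cw) F)"
    then obtain k c cw F where cox: "coxeter_element G S c" and cw: "reduced_expression G S cw c"
      and F: "F \<in> multi_cluster_complex G S k cw"
      and iso: "simplicial_isomorphic K (link (multi_cluster_complex G S k cw) F)" by blast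
    have supp: "set cw = S" by (rule coxeter_element_support[OF fin cox cw])
    define T where "T = concat (replicate k cw) @ c_sorting_word G S cw"
    have M: "multi_cluster_complex G S k cw = subword_complex G S T ?w"
      unfolding multi_cluster_complex_def T_def ..
    have "set (concat (replicate k cw)) \<subseteq> S" using supp by auto
    moreover have "c_sorting_word G S cw \<in> lists S"
      using reduced_c_sorting_word[OF fin supp] by (simp add: reduced_expression_def)
    ultimately have T: "T \<in> lists S" by (auto simp: T_def lists_eq_set)
    let ?Q = "nths T (- F)"
    have Q: "?Q \<in> lists S" by (rule nths_in_lists[OF T])
    have "?w \<in> subs ?Q" using F unfolding M by (simp add: subword_complex_iff)
    \<comment> \<open>No element is longer than the longest one, so a word containing a reduced
      expression of it has it as Demazure product.\<close>
    then have "dem ?Q = ?w" by (rule dem_eq_longest[OF fin Q])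
    then have "simplicial_sphere (subword_complex G S ?Q ?w)" by (rule subword_sphere[OF Q])
    moreover have "simplicial_isomorphic K (subword_complex G S ?Q ?w)"
      using iso link_subword_complex[OF F[unfolded M]] unfolding M by (rule simplicial_isomorphic_trans)
    ultimately show "\<exists>Q x. Q \<in> lists S \<and> x \<in> carrier G \<and> simplicial_sphere (subword_complex G S Q x) \<and>
             simplicial_isomorphic K (subword_complex G S Q x)"
      using Q longest_closed[OF fin] by metis
  qed
qed

end
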